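(* Let $n\geq 4$ and let $H$ be a graph on $n-2$ vertices with $e(H)\leq n-4$; regard $H$ as a subgraph of the complete graph $K_n$ on a subset of $n-2$ of its vertices. Suppose that every graph $\Gamma$ on $m$ vertices with $3\leq m\leq n-1$ and $e(\overline{\Gamma})\leq m-3$ satisfies $q(\Gamma)=2$. Then $q(K_n - E(H)) = 2$, where $K_n-E(H)$ is the graph obtained from $K_n$ by deleting the edges of $H$.
   Context: All graphs are finite and simple; $\overline{G}$ denotes the complement of $G$ and $e(H)$ the number of edges of $H$. For a graph $G$ on $n$ vertices, $\mathcal{S}(G)$ is the set of real symmetric $n\times n$ matrices $A=[a_{ij}]$ with $a_{ij}\neq 0$ for $i\neq j$ if and only if $ij\in E(G)$ (diagonal unrestricted); $q(A)$ is the number of distinct eigenvalues of $A$ and $q(G)=\min\{q(A):A\in\mathcal{S}(G)\}$. *)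

theory Defs
  imports "Jordan_Normal_Form.Spectral_Radius"
begin

definition complete_edges :: "'a set \<Rightarrow> 'a set set" where
  "complete_edges V = {e. e \<subseteq> V \<and> card e = 2}"

definition simple_graph :: "'a set \<Rightarrow> 'a set set \<Rightarrow> bool" where
  "simple_graph V E \<longleftrightarrow> finite V \<and> E \<subseteq> complete_edges V"

definition complement_edges :: "'a set \<Rightarrow> 'a set set \<Rightarrow> 'a set set" where
  "complement_edges V E = complete_edges V - E"

text \<open>The vertices of a graph \<open>G\<close> on \<open>n\<close> vertices are labelled \<open>0, \<dots>, n - 1\<close>, so that they
  index the rows and columns of a matrix; \<open>\<S>(G)\<close> is then given by \<open>n\<close> and the edge set of \<open>G\<close>.\<close>

definition graph_matrices :: "nat \<Rightarrow> nat set set \<Rightarrow> real mat set" where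
  "graph_matrices n E = {A \<in> carrier_mat n n. transpose_mat A = A \<and>
     (\<forall>i<n. \<forall>j<n. i \<noteq> j \<longrightarrow> (A $$ (i, j) \<noteq> 0 \<longleftrightarrow> {i, j} \<in> E))}"

text \<open>All eigenvalues of a real symmetric matrix are real, so it suffices to count the real ones.\<close>

definition q_mat :: "real mat \<Rightarrow> nat" where
  "q_mat A = card (spectrum A)"

definition q_graph :: "nat \<Rightarrow> nat set set \<Rightarrow> nat" where
  "q_graph n E = (LEAST k. \<exists>A \<in> graph_matrices n E. q_mat A = k)"

lemma graph_matrices_nonempty: "graph_matrices n E \<noteq> {}"
proof -
  let ?A = "mat n n (\<lambda>(i, j). if {i, j} \<in> E then 1 else 0) :: real mat"
  have sym: "{i, j} \<in> E \<longleftrightarrow> {j, i} \<in> E" for i j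
    by (rule arg_cong[where f = "\<lambda>e. e \<in> E"]) (rule insert_commute)
  have "transpose_mat ?A = ?A"
  proof (rule eq_matI)
    fix i j
    assume "i < dim_row ?A" "j < dim_col ?A"
    then show "transpose_mat ?A $$ (i, j) = ?A $$ (i, j)"
      using sym[of i j] by simp
  qed simp_all
  then have "?A \<in> graph_matrices n E"
    by (simp add: graph_matrices_def)
  then show ?thesis by blast
qed

lemma q_graph_attained: "\<exists>A \<in> graph_matrices n E. q_mat A = q_graph n E"
proof -
  obtain A where A: "A \<in> graph_matrices n E"
    using graph_matrices_nonempty by blast
  show ?thesis
    unfolding q_graph_def
    by (rule LeastI[where P = "\<lambda>k. \<exists>A \<in> graph_matrices n E. q_mat A = k" and k = "q_mat A"])
      (rule bexI[OF refl A])
qed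

lemma q_graph_le: "A \<in> graph_matrices n E \<Longrightarrow> q_graph n E \<le> q_mat A"
  unfolding q_graph_def by (rule Least_le) blast

end

theory Submission
  imports Defs "Jordan_Normal_Form.Jordan_Normal_Form_Uniqueness"
begin

text \<open>A graph with an edge has \<open>q = 2\<close> iff some symmetric idempotent has its pattern, i.e. iff it is
  the non-orthogonality graph of a Parseval frame. As \<open>H\<close> has at least two more vertices than edges,
  its vertex set splits into nonempty \<open>W1, W2\<close> with no edge in between and fewer edges than vertices
  in each. Adding the two vertices \<open>u, v\<close> outside \<open>H\<close> to \<open>W1\<close> and to \<open>W2\<close> gives two smaller
  graphs that satisfy the hypothesis, hence two idempotents.

  Let \<open>\<alpha>1 < \<alpha>2\<close> and \<open>\<beta>1 < \<beta>2\<close> be the eigenvalues of their \<open>2 \<times> 2\<close> blocks on \<open>{u, v}\<close>, which are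
  distinct since \<open>u\<close> and \<open>v\<close> are adjacent. Drop \<open>u\<close> and \<open>v\<close> from both frames, amalgamate the two
  spaces along a line if \<open>\<alpha>1 + \<beta>1 < 1 < \<alpha>2 + \<beta>2\<close> and along a plane if \<open>\<alpha>1 + \<beta>1 \<ge> 1\<close> (the case
  \<open>\<alpha>2 + \<beta>2 \<le> 1\<close> follows by complementing the idempotents): what is missing for a Parseval frame then
  has rank two, and two new vectors supply it. Inner products inside \<open>W1\<close> and inside \<open>W2\<close> do not
  change, and a generic choice of the line or of the identification of the planes, and of the
  rotation of the new pair, makes all other inner products nonzero.\<close>

section \<open>Symmetric matrices with two eigenvalues\<close>

text \<open>The value \<open>S\<close> of the Hermitian form at an eigenvector is \<open>z\<close>
  times the squared norm \<open>N\<close>, and symmetry makes \<open>S\<close> its own conjugate. As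
  \<open>N\<close> is positive, \<open>z\<close> equals its conjugate.\<close>

lemma real_eigenvalue_of_real_symmetric:
  assumes A: "(A :: real mat) \<in> carrier_mat n n" and sym: "transpose_mat A = A"
    and ev: "eigenvalue (map_mat complex_of_real A) z"
  shows "z \<in> \<real>"
proof -
  obtain v where v: "v \<in> carrier_vec n" "v \<noteq> 0\<^sub>v n"
    and Av: "map_mat complex_of_real A *\<^sub>v v = z \<cdot>\<^sub>v v"
    using ev A unfolding eigenvalue_def eigenvector_def by auto
  have Aji: "A $$ (j, i) = A $$ (i, j)" if "i < n" "j < n" for i j
    using that A sym by (metis carrier_matD index_transpose_mat(1))
  have row: "(\<Sum>j<n. complex_of_real (A $$ (i, j)) * v $ j) = z * v $ i" if "i < n" for i
  proof -
    have "(map_mat complex_of_real A *\<^sub>v v) $ i = z * v $ i"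
      using Av that v by simp
    then show ?thesis
      using that A v by (simp add: scalar_prod_def atLeast0LessThan)
  qed
  define N where "N = (\<Sum>i<n. (cmod (v $ i))\<^sup>2)"
  define S where "S = (\<Sum>i<n. \<Sum>j<n. cnj (v $ i) * complex_of_real (A $$ (i, j)) * v $ j)"
  have "S = (\<Sum>i<n. cnj (v $ i) * (z * v $ i))"
    unfolding S_def by (intro sum.cong refl) (simp add: row[symmetric] sum_distrib_left mult.assoc)
  also have "\<dots> = z * of_real N"
    unfolding N_def of_real_sum sum_distrib_left
    by (intro sum.cong refl) (simp add: complex_norm_square del: of_real_power)
  finally have S1: "S = z * of_real N" .
  have "cnj S = (\<Sum>i<n. \<Sum>j<n. v $ i * complex_of_real (A $$ (i, j)) * cnj (v $ j))"
    unfolding S_def by simp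
  also have "\<dots> = (\<Sum>j<n. \<Sum>i<n. v $ i * complex_of_real (A $$ (i, j)) * cnj (v $ j))"
    by (rule sum.swap)
  also have "\<dots> = S"
    unfolding S_def by (intro sum.cong refl) (simp add: Aji)
  finally have "cnj S = S" .
  moreover obtain i where i: "i < n" "v $ i \<noteq> 0"
    using v by (metis carrier_vecD eq_vecI index_zero_vec)
  have "N > 0"
    unfolding N_def by (rule sum_pos2[of _ i]) (use i in auto)
  ultimately have "cnj z = z"
    using S1 by simp
  then show ?thesis
    by (simp add: complex_is_Real_iff complex_eq_iff)
qed

text \<open>The polynomial splits over the complex numbers and its roots there are real, so the
  factorization descends along the injective embedding of real polynomials. The list of roots is the
  input of the Schur decomposition below.\<close>

lemma char_poly_real_symmetric_splits:
  assumes A: "(A :: real mat) \<in> carrier_mat n n" and sym: "transpose_mat A = A"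
  shows "\<exists>es. char_poly A = (\<Prod>e\<leftarrow>es. [:- e, 1:])"
proof -
  let ?A = "map_mat complex_of_real A"
  have cA: "?A \<in> carrier_mat n n" using A by simp
  obtain zs where zs: "char_poly ?A = (\<Prod>z\<leftarrow>zs. [:- z, 1:])"
    using char_poly_factorized[OF cA] by blast
  have "z \<in> \<real>" if "z \<in> set zs" for z
  proof -
    have "poly (char_poly ?A) z = 0"
      unfolding zs using that by (simp add: poly_prod_list prod_list_zero_iff)
    then show ?thesis
      using real_eigenvalue_of_real_symmetric[OF A sym] eigenvalue_root_char_poly[OF cA] by blast
  qed
  then have zs': "zs = map complex_of_real (map Re zs)"
    by (simp add: map_idI)
  interpret h: map_poly_inj_idom_hom complex_of_real ..
  have "map_poly complex_of_real (char_poly A) = (\<Prod>z\<leftarrow>map complex_of_real (map Re zs). [:- z, 1:])"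
    unfolding of_real_hom.char_poly_hom[OF A, symmetric] zs using zs' by simp
  also have "\<dots> = map_poly complex_of_real (\<Prod>e\<leftarrow>map Re zs. [:- e, 1:])"
    by (simp add: h.hom_prod_list o_def)
  finally show ?thesis
    using h.injectivity by blast
qed

text \<open>With row i of a matrix A for \<open>f\<close> and column j for \<open>g\<close>, this
  writes out an entry of (A - a)(A - b).\<close>

lemma sum_mult_shifted:
  fixes f g :: "nat \<Rightarrow> real"
  assumes "i < n" "j < n"
  shows "(\<Sum>k<n. (f k - (if i = k then a else 0)) * (g k - (if k = j then b else 0))) =
    (\<Sum>k<n. f k * g k) - b * f j - a * g i + (if i = j then a * b else 0)"
proof -
  have "(f k - (if i = k then a else 0)) * (g k - (if k = j then b else 0)) =
      f k * g k - (if k = j then b * f k else 0) - (if i = k then a * g k else 0)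
      + (if i = k then (if k = j then a * b else 0) else 0)" for k
    by (auto simp: algebra_simps)
  then show ?thesis
    using assms by (simp only: sum.distrib sum_subtractf) simp
qed

lemma char_matrix_mult_entry:
  assumes A: "(A :: real mat) \<in> carrier_mat n n" and ij: "i < n" "j < n"
  shows "(char_matrix A a * char_matrix A b) $$ (i, j) =
    (A * A) $$ (i, j) - (a + b) * A $$ (i, j) + (if i = j then a * b else 0)"
proof -
  have "(char_matrix A a * char_matrix A b) $$ (i, j) =
      (\<Sum>k<n. (A $$ (i, k) - (if i = k then a else 0)) * (A $$ (k, j) - (if k = j then b else 0)))"
    using A ij by (auto simp: char_matrix_def scalar_prod_def atLeast0LessThan intro!: sum.cong)
  also have "\<dots> = (\<Sum>k<n. A $$ (i, k) * A $$ (k, j)) - a * A $$ (i, j) - b * A $$ (i, j)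
      + (if i = j then a * b else 0)"
    using sum_mult_shifted[OF ij, of "\<lambda>k. A $$ (i, k)" a "\<lambda>k. A $$ (k, j)" b] by simp
  also have "(\<Sum>k<n. A $$ (i, k) * A $$ (k, j)) = (A * A) $$ (i, j)"
    using A ij by (simp add: scalar_prod_def atLeast0LessThan)
  finally show ?thesis by (simp add: algebra_simps)
qed

lemma upper_triangular_mult:
  assumes "(S :: real mat) \<in> carrier_mat n n" "T \<in> carrier_mat n n"
    and S: "upper_triangular S" and T: "upper_triangular T"
  shows "upper_triangular (S * T)" and "i < n \<Longrightarrow> (S * T) $$ (i, i) = S $$ (i, i) * T $$ (i, i)"
proof -
  have ent: "(S * T) $$ (i, j) = (\<Sum>k<n. S $$ (i, k) * T $$ (k, j))" if "i < n" "j < n" for i j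
    using assms that by (simp add: scalar_prod_def atLeast0LessThan)
  have z: "S $$ (i, k) * T $$ (k, j) = 0" if "i < n" "k < n" "k < i \<or> j < k" for i j k
    using upper_triangularD[OF S, of k i] upper_triangularD[OF T, of j k] that assms by auto
  show "upper_triangular (S * T)"
  proof (rule upper_triangularI)
    fix i j assume "j < i" "i < dim_row (S * T)"
    then have ij: "i < n" "j < n" "j < i" using assms by auto
    have "S $$ (i, k) * T $$ (k, j) = 0" if "k < n" for k
      by (rule z) (use ij that in auto)
    then show "(S * T) $$ (i, j) = 0" unfolding ent[OF ij(1,2)] by (intro sum.neutral) auto
  qed
  show "(S * T) $$ (i, i) = S $$ (i, i) * T $$ (i, i)" if i: "i < n"
  proof -
    have "(S * T) $$ (i, i) = (\<Sum>k\<in>{i}. S $$ (i, k) * T $$ (k, i))"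
      unfolding ent[OF i i]
    proof (rule sum.mono_neutral_right)
      show "\<forall>k\<in>{..<n} - {i}. S $$ (i, k) * T $$ (k, i) = 0"
        using z[OF i] by (metis Diff_iff insertI1 lessThan_iff nat_neq_iff)
    qed (use i in auto)
    then show ?thesis by simp
  qed
qed

lemma trace_mult_commute:
  assumes "(S :: real mat) \<in> carrier_mat n n" "T \<in> carrier_mat n n"
  shows "(\<Sum>i<n. (S * T) $$ (i, i)) = (\<Sum>i<n. (T * S) $$ (i, i))"
proof -
  have "(\<Sum>i<n. (S * T) $$ (i, i)) = (\<Sum>i<n. \<Sum>k<n. S $$ (i, k) * T $$ (k, i))"
    using assms by (simp add: scalar_prod_def atLeast0LessThan)
  also have "\<dots> = (\<Sum>k<n. \<Sum>i<n. S $$ (i, k) * T $$ (k, i))"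
    by (rule sum.swap)
  also have "\<dots> = (\<Sum>i<n. (T * S) $$ (i, i))"
    using assms by (simp add: scalar_prod_def atLeast0LessThan mult.commute)
  finally show ?thesis .
qed

text \<open>With \<open>B = (A - a)(A - b)\<close> symmetric, \<open>trace (B * B)\<close> is the sum of the squares of the entries
  of \<open>B\<close>; it is also the trace of a triangular matrix with zero diagonal, by Schur.\<close>

lemma symmetric_two_eigenvalues:
  assumes A: "(A :: real mat) \<in> carrier_mat n n" and sym: "transpose_mat A = A"
    and spec: "spectrum A \<subseteq> {a, b}" and ij: "i < n" "j < n"
  shows "(A * A) $$ (i, j) = (a + b) * A $$ (i, j) - (if i = j then a * b else 0)"
proof -
  obtain es where es: "char_poly A = (\<Prod>e\<leftarrow>es. [:- e, 1:])"
    using char_poly_real_symmetric_splits[OF A sym] by blast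
  obtain T P Q where dec: "schur_decomposition A es = (T, P, Q)"
    by (cases "schur_decomposition A es") auto
  have wit: "similar_mat_wit A T P Q" and T: "upper_triangular T" and diag: "diag_mat T = es"
    using schur_decomposition[OF A es dec] by auto
  note car = similar_mat_witD2[OF A wit]
  have PQ: "P \<in> carrier_mat n n" "Q \<in> carrier_mat n n" "Q * P = 1\<^sub>m n" and Tc: "T \<in> carrier_mat n n"
    using car by auto
  have Tii: "T $$ (k, k) = a \<or> T $$ (k, k) = b" if "k < n" for k
  proof -
    have "T $$ (k, k) \<in> set es"
      unfolding diag[symmetric] diag_mat_def using that Tc by auto
    then have "poly (char_poly A) (T $$ (k, k)) = 0"
      unfolding es by (simp add: poly_prod_list prod_list_zero_iff)
    then show ?thesis
      using spec eigenvalue_root_char_poly[OF A] by (auto simp: spectrum_def)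
  qed
  define L where "L = char_matrix T a"
  define M where "M = char_matrix T b"
  have LM: "L \<in> carrier_mat n n" "M \<in> carrier_mat n n"
    using Tc by (auto simp: L_def M_def)
  have ut: "upper_triangular L" "upper_triangular M"
    using T Tc by (auto simp: L_def M_def char_matrix_def upper_triangular_def)
  have witL: "char_matrix A a = P * L * Q" and witM: "char_matrix A b = P * M * Q"
    using similar_mat_wit_char_matrix[OF wit] A unfolding L_def M_def similar_mat_wit_def Let_def
    by auto
  define B where "B = char_matrix A a * char_matrix A b"
  have Bc: "B \<in> carrier_mat n n"
    unfolding B_def by (rule mult_carrier_mat[OF char_matrix_closed[OF A] char_matrix_closed[OF A]])
  \<comment> \<open>Conjugation by \<open>P\<close> and its inverse \<open>Q\<close> respects
    products, so \<open>B * B\<close> is conjugate to a product of triangular matrices.\<close>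
  have cancel: "P * X * Q * (P * Y * Q) = P * (X * Y) * Q"
    if "X \<in> carrier_mat n n" "Y \<in> carrier_mat n n" for X Y
  proof -
    have "P * X * Q * (P * Y * Q) = P * X * ((Q * P) * (Y * Q))"
      using that PQ(1,2) by (simp add: assoc_mult_mat[of _ n n _ n _ n])
    also have "\<dots> = P * X * (Y * Q)" using that PQ by simp
    also have "\<dots> = P * (X * Y) * Q"
      using that PQ(1,2) by (simp add: assoc_mult_mat[of _ n n _ n _ n])
    finally show ?thesis .
  qed
  have BB: "B * B = P * (L * M * (L * M)) * Q"
    unfolding B_def witL witM using LM by (simp add: cancel)
  have Bsym: "B $$ (k, l) = B $$ (l, k)" if "k < n" "l < n" for k l
  proof -
    have Akl: "A $$ (k, l) = A $$ (l, k)" if "k < n" "l < n" for k l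
      using that A sym by (metis carrier_matD index_transpose_mat(1))
    then have "(A * A) $$ (k, l) = (A * A) $$ (l, k)"
      using that A by (auto simp: scalar_prod_def intro!: sum.cong)
    then show ?thesis
      unfolding B_def char_matrix_mult_entry[OF A that] char_matrix_mult_entry[OF A that(2,1)]
      using Akl[OF that] by auto
  qed
  have "(\<Sum>k<n. \<Sum>l<n. (B $$ (k, l))\<^sup>2) = (\<Sum>k<n. (B * B) $$ (k, k))"
    using Bc Bsym by (auto simp: scalar_prod_def atLeast0LessThan power2_eq_square intro!: sum.cong)
  also have "\<dots> = (\<Sum>k<n. (Q * (P * (L * M * (L * M)))) $$ (k, k))"
    unfolding BB by (rule trace_mult_commute) (use PQ LM in auto)
  also have "Q * (P * (L * M * (L * M))) = (Q * P) * (L * M * (L * M))"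
    using PQ(1,2) LM by (simp add: assoc_mult_mat[of _ n n _ n _ n])
  also have "\<dots> = L * M * (L * M)" using PQ LM by simp
  also have "(\<Sum>k<n. (L * M * (L * M)) $$ (k, k)) = 0"
  proof (rule sum.neutral, rule ballI)
    fix k assume "k \<in> {..<n}"
    then have k: "k < n" by simp
    \<comment> \<open>Every diagonal entry of \<open>T\<close> is an eigenvalue, hence
      \<open>a\<close> or \<open>b\<close>, so one of the two shifted factors vanishes.\<close>
    have "L $$ (k, k) * M $$ (k, k) = 0"
      using Tii[OF k] k Tc by (auto simp: L_def M_def char_matrix_def)
    then show "(L * M * (L * M)) $$ (k, k) = 0"
      using k LM ut upper_triangular_mult[of "L * M" n "L * M"] upper_triangular_mult[of L n M] by simp
  qed
  finally have "(\<Sum>k<n. \<Sum>l<n. (B $$ (k, l))\<^sup>2) = 0" .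
  then have "B $$ (i, j) = 0"
    using ij by (simp add: sum_nonneg_eq_0_iff sum_nonneg)
  then show ?thesis
    unfolding B_def char_matrix_mult_entry[OF A ij] by (simp add: algebra_simps)
qed

section \<open>Symmetric idempotents and the value q = 2\<close>

text \<open>Matrices are functions of two indices from here on, so that blocks and bordered matrices
  can be indexed by sets of vertices without renumbering.\<close>

definition symmetric_idempotent :: "'a set \<Rightarrow> ('a \<Rightarrow> 'a \<Rightarrow> real) \<Rightarrow> bool" where
  "symmetric_idempotent V p \<longleftrightarrow>
     (\<forall>i\<in>V. \<forall>j\<in>V. p i j = p j i \<and> (\<Sum>k\<in>V. p i k * p k j) = p i j)"

lemma symmetric_idempotentD:
  assumes "symmetric_idempotent V p" "i \<in> V" "j \<in> V"
  shows "p i j = p j i" and "(\<Sum>k\<in>V. p i k * p k j) = p i j"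
  using assms unfolding symmetric_idempotent_def by blast+

definition has_pattern :: "'a set \<Rightarrow> 'a set set \<Rightarrow> ('a \<Rightarrow> 'a \<Rightarrow> real) \<Rightarrow> bool" where
  "has_pattern V E p \<longleftrightarrow> (\<forall>i\<in>V. \<forall>j\<in>V. i \<noteq> j \<longrightarrow> (p i j \<noteq> 0 \<longleftrightarrow> {i, j} \<in> E))"

lemma graph_matrices_sym_entry:
  assumes "A \<in> graph_matrices n E" "i < n" "j < n"
  shows "A $$ (i, j) = A $$ (j, i)"
proof -
  have "dim_row A = n" "dim_col A = n" "transpose_mat A = A"
    using assms(1) by (auto simp: graph_matrices_def)
  then show ?thesis
    using index_transpose_mat(1)[of j A i] assms(2,3) by simp
qed

text \<open>Moving the two eigenvalues to 0 and 1 turns a minimizer A into the idempotent (A - a)/(b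
  - a). The shift changes only the diagonal and the scaling factor is nonzero, so the pattern
  survives.\<close>

lemma idempotent_of_q_graph_2:
  assumes "q_graph n E = 2"
  shows "\<exists>p. symmetric_idempotent {0..<n} p \<and> has_pattern {0..<n} E p"
proof -
  obtain A where A: "A \<in> graph_matrices n E" and "q_mat A = 2"
    using q_graph_attained[of n E] assms by auto
  then obtain a b where ab: "spectrum A = {a, b}" "a \<noteq> b"
    unfolding q_mat_def by (auto simp: card_2_iff)
  have Ac: "A \<in> carrier_mat n n" "transpose_mat A = A"
    and pat: "\<And>i j. i < n \<Longrightarrow> j < n \<Longrightarrow> i \<noteq> j \<Longrightarrow> A $$ (i, j) \<noteq> 0 \<longleftrightarrow> {i, j} \<in> E"
    using A by (auto simp: graph_matrices_def)
  define p where "p i j = (A $$ (i, j) - (if i = j then a else 0)) / (b - a)" for i j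
  have scale: "c\<^sup>2 * (x / c * (y / c)) = x * y" if "c \<noteq> 0" for c x y :: real
    using that by (simp add: power2_eq_square)
  have "symmetric_idempotent {0..<n} p"
    unfolding symmetric_idempotent_def
  proof (intro ballI conjI)
    fix i j assume "i \<in> {0..<n}" "j \<in> {0..<n}"
    then have ij: "i < n" "j < n" by auto
    show "p i j = p j i"
      using graph_matrices_sym_entry[OF A ij] by (cases "i = j") (simp_all add: p_def)
    have "(b - a)\<^sup>2 * (\<Sum>k<n. p i k * p k j) =
        (\<Sum>k<n. (A $$ (i, k) - (if i = k then a else 0)) * (A $$ (k, j) - (if k = j then a else 0)))"
      unfolding sum_distrib_left p_def by (intro sum.cong refl scale) (use ab(2) in simp)
    also have "\<dots> = (\<Sum>k<n. A $$ (i, k) * A $$ (k, j)) - 2 * a * A $$ (i, j)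
        + (if i = j then a * a else 0)"
      using sum_mult_shifted[OF ij, of "\<lambda>k. A $$ (i, k)" a "\<lambda>k. A $$ (k, j)" a] by simp
    also have "(\<Sum>k<n. A $$ (i, k) * A $$ (k, j)) = (A * A) $$ (i, j)"
      using Ac ij by (simp add: scalar_prod_def atLeast0LessThan)
    also have "(A * A) $$ (i, j) = (a + b) * A $$ (i, j) - (if i = j then a * b else 0)"
      by (rule symmetric_two_eigenvalues[OF Ac _ ij]) (use ab in auto)
    finally have "(b - a)\<^sup>2 * (\<Sum>k<n. p i k * p k j) =
        (b - a) * (A $$ (i, j) - (if i = j then a else 0))" (is "_ * ?s = _ * ?d")
      by (cases "i = j") (simp_all add: ring_distribs)
    also have "?d = p i j * (b - a)"
      by (rule nonzero_eq_divide_eq[THEN iffD1, OF _ p_def, symmetric]) (use ab(2) in simp)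
    also have "(b - a) * (p i j * (b - a)) = (b - a)\<^sup>2 * p i j"
      by (simp only: power2_eq_square ac_simps)
    finally have "(b - a)\<^sup>2 * ?s = (b - a)\<^sup>2 * p i j" .
    moreover have "(b - a)\<^sup>2 \<noteq> 0" using ab(2) by simp
    ultimately have "?s = p i j" by (rule mult_left_cancel[THEN iffD1, rotated])
    then show "(\<Sum>k\<in>{0..<n}. p i k * p k j) = p i j"
      by (simp only: atLeast0LessThan)
  qed
  moreover have "has_pattern {0..<n} E p"
    unfolding has_pattern_def
  proof (intro ballI impI)
    fix i j assume "i \<in> {0..<n}" "j \<in> {0..<n}" "i \<noteq> j"
    then show "p i j \<noteq> 0 \<longleftrightarrow> {i, j} \<in> E"
      using pat[of i j] ab(2) by (simp add: p_def)
  qed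
  ultimately show ?thesis by blast
qed

text \<open>If \<open>a\<close> were the only eigenvalue, the square of A - a would vanish. Its
  entry at (i, i) is the squared norm of row i of A - a, and this row contains the nonzero entry at
  (i, j).\<close>

lemma q_mat_ge_2:
  assumes A: "A \<in> graph_matrices n E" and ij: "i < n" "j < n" "i \<noteq> j" "{i, j} \<in> E"
  shows "q_mat A \<ge> 2"
proof (rule ccontr)
  assume "\<not> q_mat A \<ge> 2"
  have Ac: "A \<in> carrier_mat n n" "transpose_mat A = A"
    and pat: "A $$ (i, j) \<noteq> 0"
    using A ij by (auto simp: graph_matrices_def)
  have fin: "finite (spectrum A)" by (rule card_finite_spectrum[OF Ac(1)])
  have "card (spectrum A) \<le> Suc 0"
    using \<open>\<not> q_mat A \<ge> 2\<close> by (simp add: q_mat_def)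
  note eq = card_le_Suc0_iff_eq[OF fin, THEN iffD1, OF this]
  \<comment> \<open>The two candidate eigenvalues coincide: in this degenerate case the quadratic
    equation of the matrix says that A - a has square zero.\<close>
  obtain a where a: "spectrum A \<subseteq> {a, a}"
  proof (cases "spectrum A = {}")
    case False
    then obtain x where "x \<in> spectrum A" by blast
    then show ?thesis using eq that[of x] by blast
  qed (use that in blast)
  have sym: "A $$ (k, i) = A $$ (i, k)" if "k < n" for k
    using graph_matrices_sym_entry[OF A that ij(1)] .
  have "(\<Sum>k<n. (A $$ (i, k) - (if i = k then a else 0))\<^sup>2) =
      (\<Sum>k<n. (A $$ (i, k) - (if i = k then a else 0)) * (A $$ (k, i) - (if k = i then a else 0)))"
  proof (intro sum.cong refl)
    fix k assume "k \<in> {..<n}"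
    then have "A $$ (k, i) - (if k = i then a else 0) = A $$ (i, k) - (if i = k then a else 0)"
      by (subst sym) auto
    then show "(A $$ (i, k) - (if i = k then a else 0))\<^sup>2 =
        (A $$ (i, k) - (if i = k then a else 0)) * (A $$ (k, i) - (if k = i then a else 0))"
      by (simp only: power2_eq_square)
  qed
  also have "\<dots> = (\<Sum>k<n. A $$ (i, k) * A $$ (k, i)) - a * A $$ (i, i) - a * A $$ (i, i) + a * a"
    using sum_mult_shifted[OF ij(1) ij(1), of "\<lambda>k. A $$ (i, k)" a "\<lambda>k. A $$ (k, i)" a] by simp
  also have "(\<Sum>k<n. A $$ (i, k) * A $$ (k, i)) = (A * A) $$ (i, i)"
    using Ac ij by (simp add: scalar_prod_def atLeast0LessThan)
  also have "(A * A) $$ (i, i) = (a + a) * A $$ (i, i) - (if i = i then a * a else 0)"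
    by (rule symmetric_two_eigenvalues[OF Ac a]) (use ij in auto)
  finally have "(\<Sum>k<n. (A $$ (i, k) - (if i = k then a else 0))\<^sup>2) = 0"
    by simp
  then have "A $$ (i, j) - (if i = j then a else 0) = 0"
    using ij by (simp add: sum_nonneg_eq_0_iff)
  then show False using pat ij by simp
qed

text \<open>An eigenvalue of an idempotent satisfies k = k * k, which leaves at most two values; the
  edge rules out fewer.\<close>

lemma q_graph_2_of_idempotent:
  assumes p: "symmetric_idempotent {0..<n} p" and pat: "has_pattern {0..<n} E p"
    and ij: "i < n" "j < n" "i \<noteq> j" "{i, j} \<in> E"
  shows "q_graph n E = 2"
proof -
  define A where "A = mat n n (\<lambda>(i, j). p i j)"
  have psym: "p i j = p j i" if "i < n" "j < n" for i j
    by (rule symmetric_idempotentD(1)[OF p]) (use that in auto)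
  have pp: "(\<Sum>k\<in>{0..<n}. p i k * p k j) = p i j" if "i < n" "j < n" for i j
    by (rule symmetric_idempotentD(2)[OF p]) (use that in auto)
  have Ac: "A \<in> carrier_mat n n" by (simp add: A_def)
  have "transpose_mat A = A"
    by (rule eq_matI) (simp_all add: A_def psym)
  then have A: "A \<in> graph_matrices n E"
    using pat by (auto simp: graph_matrices_def has_pattern_def A_def)
  have AA: "A * A = A"
    by (rule eq_matI) (auto simp: A_def scalar_prod_def pp)
  have "spectrum A \<subseteq> {0, 1}"
  proof
    fix k assume "k \<in> spectrum A"
    then obtain v where v: "v \<in> carrier_vec n" "v \<noteq> 0\<^sub>v n" "A *\<^sub>v v = k \<cdot>\<^sub>v v"
      using Ac by (auto simp: spectrum_def eigenvalue_def eigenvector_def)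
    have "k \<cdot>\<^sub>v v = A *\<^sub>v (A *\<^sub>v v)"
      using v Ac AA assoc_mult_mat_vec[OF Ac Ac v(1)] by simp
    also have "\<dots> = k \<cdot>\<^sub>v (k \<cdot>\<^sub>v v)"
      unfolding v(3) mult_mat_vec[OF Ac v(1)] by simp
    finally have eq: "k \<cdot>\<^sub>v v = k \<cdot>\<^sub>v (k \<cdot>\<^sub>v v)" .
    obtain l where l: "l < n" "v $ l \<noteq> 0"
      using v by (metis carrier_vecD eq_vecI index_zero_vec)
    have "(k \<cdot>\<^sub>v v) $ l = (k \<cdot>\<^sub>v (k \<cdot>\<^sub>v v)) $ l" using eq by simp
    then have "k = k * k" using l v by simp
    then show "k \<in> {0, 1}" by simp
  qed
  then have "q_mat A \<le> 2"
    unfolding q_mat_def using card_mono[of "{0, 1 :: real}" "spectrum A"] by simp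
  then have "q_graph n E \<le> 2"
    using q_graph_le[OF A] by simp
  moreover have "q_graph n E \<ge> 2"
    using q_graph_attained[of n E] q_mat_ge_2[OF _ ij] by metis
  ultimately show ?thesis by simp
qed

lemma idempotent_transport:
  assumes f: "bij_betw f U V" and p: "symmetric_idempotent V p" and pat: "has_pattern V ((`) f ` E) p"
    and E: "E \<subseteq> Pow U"
  shows "symmetric_idempotent U (\<lambda>i j. p (f i) (f j)) \<and> has_pattern U E (\<lambda>i j. p (f i) (f j))"
proof
  have fV: "f i \<in> V" if "i \<in> U" for i using f that by (auto simp: bij_betw_def)
  show "symmetric_idempotent U (\<lambda>i j. p (f i) (f j))"
    unfolding symmetric_idempotent_def
  proof (intro ballI conjI)
    fix i j assume ij: "i \<in> U" "j \<in> U"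
    show "p (f i) (f j) = p (f j) (f i)"
      by (rule symmetric_idempotentD(1)[OF p fV fV]) (use ij in auto)
    have "(\<Sum>k\<in>U. p (f i) (f k) * p (f k) (f j)) = (\<Sum>k\<in>V. p (f i) k * p k (f j))"
      by (rule sum.reindex_bij_betw[OF f])
    also have "\<dots> = p (f i) (f j)"
      by (rule symmetric_idempotentD(2)[OF p fV fV]) (use ij in auto)
    finally show "(\<Sum>k\<in>U. p (f i) (f k) * p (f k) (f j)) = p (f i) (f j)" .
  qed
  show "has_pattern U E (\<lambda>i j. p (f i) (f j))"
    unfolding has_pattern_def
  proof (intro ballI impI)
    fix i j assume ij: "i \<in> U" "j \<in> U" "i \<noteq> j"
    then have "f i \<noteq> f j" using f by (auto simp: bij_betw_def inj_on_def)
    then have "p (f i) (f j) \<noteq> 0 \<longleftrightarrow> f ` {i, j} \<in> (`) f ` E"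
      using pat fV ij by (auto simp: has_pattern_def)
    also have "\<dots> \<longleftrightarrow> {i, j} \<in> E"
    proof -
      \<comment> \<open>Injectivity of \<open>f\<close> is known on \<open>U\<close> only, so its
        action on sets is injective on subsets of \<open>U\<close>; the edges are such
        subsets.\<close>
      have "inj_on ((`) f) (Pow U)"
        using f by (simp add: bij_betw_def inj_on_image_Pow)
      then show ?thesis
        using E ij by (intro inj_on_image_mem_iff[where B = "Pow U"]) auto
    qed
    finally show "p (f i) (f j) \<noteq> 0 \<longleftrightarrow> {i, j} \<in> E" .
  qed
qed

section \<open>Idempotents with two distinguished indices\<close>

text \<open>The block matrix with diagonal blocks \<open>A\<close> and \<open>(\<alpha> \<gamma>; \<gamma> \<beta>)\<close> and off-diagonal columns \<open>b, c\<close> is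
  a symmetric idempotent.\<close>

definition bordered_idempotent ::
    "'a set \<Rightarrow> ('a \<Rightarrow> 'a \<Rightarrow> real) \<Rightarrow> ('a \<Rightarrow> real) \<Rightarrow> ('a \<Rightarrow> real) \<Rightarrow> real \<Rightarrow> real \<Rightarrow> real \<Rightarrow> bool" where
  "bordered_idempotent W A b c \<alpha> \<gamma> \<beta> \<longleftrightarrow> finite W \<and>
     (\<forall>i\<in>W. \<forall>j\<in>W. A i j = A j i) \<and>
     (\<forall>i\<in>W. \<forall>j\<in>W. (\<Sum>k\<in>W. A i k * A k j) = A i j - b i * b j - c i * c j) \<and>
     (\<forall>i\<in>W. (\<Sum>k\<in>W. A i k * b k) = b i - \<alpha> * b i - \<gamma> * c i) \<and>
     (\<forall>i\<in>W. (\<Sum>k\<in>W. A i k * c k) = c i - \<gamma> * b i - \<beta> * c i) \<and>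
     (\<Sum>k\<in>W. b k * b k) = \<alpha> - \<alpha> * \<alpha> - \<gamma> * \<gamma> \<and>
     (\<Sum>k\<in>W. b k * c k) = \<gamma> - \<alpha> * \<gamma> - \<gamma> * \<beta> \<and>
     (\<Sum>k\<in>W. c k * c k) = \<beta> - \<gamma> * \<gamma> - \<beta> * \<beta>"

lemma bordered_idempotentD:
  assumes "bordered_idempotent W A b c \<alpha> \<gamma> \<beta>"
  shows "finite W"
    and "i \<in> W \<Longrightarrow> j \<in> W \<Longrightarrow> A i j = A j i"
    and "i \<in> W \<Longrightarrow> j \<in> W \<Longrightarrow> (\<Sum>k\<in>W. A i k * A k j) = A i j - b i * b j - c i * c j"
    and "i \<in> W \<Longrightarrow> (\<Sum>k\<in>W. A i k * b k) = b i - \<alpha> * b i - \<gamma> * c i"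
    and "i \<in> W \<Longrightarrow> (\<Sum>k\<in>W. A i k * c k) = c i - \<gamma> * b i - \<beta> * c i"
    and "(\<Sum>k\<in>W. b k * b k) = \<alpha> - \<alpha> * \<alpha> - \<gamma> * \<gamma>"
    and "(\<Sum>k\<in>W. b k * c k) = \<gamma> - \<alpha> * \<gamma> - \<gamma> * \<beta>"
    and "(\<Sum>k\<in>W. c k * c k) = \<beta> - \<gamma> * \<gamma> - \<beta> * \<beta>"
  using assms unfolding bordered_idempotent_def by blast+

lemma sum_insert_two:
  "finite W \<Longrightarrow> u \<notin> W \<Longrightarrow> v \<notin> W \<Longrightarrow> u \<noteq> v \<Longrightarrow>
    (\<Sum>k\<in>insert u (insert v W). f k) = f u + f v + (\<Sum>k\<in>W. f k :: real)"
  by simp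

lemma bordered_of_symmetric_idempotent:
  assumes "finite W" "u \<notin> W" "v \<notin> W" "u \<noteq> v"
    and p: "symmetric_idempotent (insert u (insert v W)) p"
  shows "bordered_idempotent W p (\<lambda>i. p i u) (\<lambda>i. p i v) (p u u) (p u v) (p v v)"
proof -
  note split = sum_insert_two[OF assms(1-4)]
  have sym: "p i j = p j i" and idem: "(\<Sum>k\<in>W. p i k * p k j) = p i j - p i u * p u j - p i v * p v j"
    if "i \<in> insert u (insert v W)" "j \<in> insert u (insert v W)" for i j
    using symmetric_idempotentD[OF p that] split[of "\<lambda>k. p i k * p k j"] by simp_all
  have su: "p k u = p u k" and sv: "p k v = p v k" if "k \<in> W" for k
    using sym that by auto
  have uv: "p v u = p u v" using sym by auto
  have uu: "(\<Sum>k\<in>W. p k u * p k u) = (\<Sum>k\<in>W. p u k * p k u)"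
    and uv': "(\<Sum>k\<in>W. p k u * p k v) = (\<Sum>k\<in>W. p u k * p k v)"
    and vv: "(\<Sum>k\<in>W. p k v * p k v) = (\<Sum>k\<in>W. p v k * p k v)"
    by (intro sum.cong refl; simp add: su sv)+
  show ?thesis
    unfolding bordered_idempotent_def
  proof (intro conjI ballI assms(1))
    fix i j assume ij: "i \<in> W" "j \<in> W"
    show "p i j = p j i" by (rule sym) (use ij in auto)
    show "(\<Sum>k\<in>W. p i k * p k j) = p i j - p i u * p j u - p i v * p j v"
      unfolding su[OF ij(2)] sv[OF ij(2)] by (rule idem) (use ij in auto)
  next
    fix i assume i: "i \<in> W"
    show "(\<Sum>k\<in>W. p i k * p k u) = p i u - p u u * p i u - p u v * p i v"
      using idem[of i u] i uv by (simp add: mult.commute)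
    show "(\<Sum>k\<in>W. p i k * p k v) = p i v - p u v * p i u - p v v * p i v"
      using idem[of i v] i by (simp add: mult.commute)
  qed (use idem[of u u] idem[of u v] idem[of v v] uu uv' vv uv in simp_all)
qed

lemma symmetric_idempotent_of_bordered:
  assumes bd: "bordered_idempotent W A b c \<alpha> \<gamma> \<beta>" and uv: "u \<notin> W" "v \<notin> W" "u \<noteq> v"
  shows "\<exists>p. symmetric_idempotent (insert u (insert v W)) p \<and> (\<forall>i\<in>W. \<forall>j\<in>W. p i j = A i j) \<and>
    (\<forall>i\<in>W. p i u = b i \<and> p u i = b i \<and> p i v = c i \<and> p v i = c i) \<and> p u v = \<gamma> \<and> p v u = \<gamma>"
proof -
  note D = bordered_idempotentD[OF bd]
  define p where "p i j =
    (if i \<in> W then (if j \<in> W then A i j else if j = u then b i else c i)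
     else if j \<in> W then (if i = u then b j else c j)
     else if i = u then (if j = u then \<alpha> else \<gamma>) else if j = u then \<gamma> else \<beta>)" for i j
  have pW: "i \<in> W \<Longrightarrow> j \<in> W \<Longrightarrow> p i j = A i j" "i \<in> W \<Longrightarrow> p i u = b i" "i \<in> W \<Longrightarrow> p u i = b i"
    "i \<in> W \<Longrightarrow> p i v = c i" "i \<in> W \<Longrightarrow> p v i = c i" "p u u = \<alpha>" "p u v = \<gamma>" "p v u = \<gamma>" "p v v = \<beta>"
    for i j
    using uv by (auto simp: p_def)
  have "symmetric_idempotent (insert u (insert v W)) p"
    unfolding symmetric_idempotent_def sum_insert_two[OF D(1) uv]
  proof (intro ballI conjI)
    fix i j assume ij: "i \<in> insert u (insert v W)" "j \<in> insert u (insert v W)"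
    then show "p i j = p j i"
      using D(2)[of i j] by (auto simp: pW)
    have "(\<Sum>k\<in>W. c k * b k) = (\<Sum>k\<in>W. b k * c k)"
      by (simp only: mult.commute)
    moreover have "(\<Sum>k\<in>W. b k * A k l) = (\<Sum>k\<in>W. A l k * b k)"
      "(\<Sum>k\<in>W. c k * A k l) = (\<Sum>k\<in>W. A l k * c k)" if "l \<in> W" for l
      using D(2) that by (auto intro!: sum.cong simp: mult.commute)
    ultimately show "p i u * p u j + p i v * p v j + (\<Sum>k\<in>W. p i k * p k j) = p i j"
      using ij by (auto simp: pW D(3-8) cong: sum.cong)
  qed
  then show ?thesis using pW by (intro exI[of _ p]) auto
qed

section \<open>Rotating and complementing the distinguished pair\<close>

lemma sum_mult_combination:
  fixes f g h :: "'a \<Rightarrow> real"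
  shows "(\<Sum>k\<in>W. h k * (p * f k + q * g k)) = p * (\<Sum>k\<in>W. h k * f k) + q * (\<Sum>k\<in>W. h k * g k)"
  by (simp add: sum_distrib_left sum.distrib algebra_simps)

lemma sum_combination_mult:
  fixes f g :: "'a \<Rightarrow> real"
  shows "(\<Sum>k\<in>W. (p * f k + q * g k) * (p' * f k + q' * g k)) =
    p * p' * (\<Sum>k\<in>W. f k * f k) + (p * q' + q * p') * (\<Sum>k\<in>W. f k * g k) + q * q' * (\<Sum>k\<in>W. g k * g k)"
  by (simp add: sum_distrib_left sum.distrib algebra_simps)

text \<open>Conjugation by a rotation of the two extra coordinates preserves symmetric idempotents
  and leaves the block \<open>A\<close> alone. Each identity is a polynomial consequence of the unit
  length of (x, y).\<close>

lemma bordered_idempotent_rotate: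
  assumes bd: "bordered_idempotent W A b c \<alpha> \<gamma> \<beta>" and xy: "x\<^sup>2 + y\<^sup>2 = 1"
  shows "bordered_idempotent W A (\<lambda>i. x * b i + y * c i) (\<lambda>i. - y * b i + x * c i)
    (x\<^sup>2 * \<alpha> + 2 * x * y * \<gamma> + y\<^sup>2 * \<beta>) ((x\<^sup>2 - y\<^sup>2) * \<gamma> + x * y * (\<beta> - \<alpha>))
    (y\<^sup>2 * \<alpha> - 2 * x * y * \<gamma> + x\<^sup>2 * \<beta>)"
proof -
  note D = bordered_idempotentD[OF bd]
  have one: "x * x = 1 - y * y" using xy by (simp add: power2_eq_square)
  show ?thesis
    unfolding bordered_idempotent_def
  proof (intro conjI ballI D(1))
    fix i j assume ij: "i \<in> W" "j \<in> W"
    show "A i j = A j i" using D(2) ij .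
    show "(\<Sum>k\<in>W. A i k * A k j) = A i j - (x * b i + y * c i) * (x * b j + y * c j) -
      (- y * b i + x * c i) * (- y * b j + x * c j)"
      unfolding D(3)[OF ij] using one by Groebner_Basis.algebra
  next
    fix i assume i: "i \<in> W"
    show "(\<Sum>k\<in>W. A i k * (x * b k + y * c k)) = x * b i + y * c i -
      (x\<^sup>2 * \<alpha> + 2 * x * y * \<gamma> + y\<^sup>2 * \<beta>) * (x * b i + y * c i) -
      ((x\<^sup>2 - y\<^sup>2) * \<gamma> + x * y * (\<beta> - \<alpha>)) * (- y * b i + x * c i)"
      unfolding sum_mult_combination D(4)[OF i] D(5)[OF i] using one by Groebner_Basis.algebra
    show "(\<Sum>k\<in>W. A i k * (- y * b k + x * c k)) = - y * b i + x * c i -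
      ((x\<^sup>2 - y\<^sup>2) * \<gamma> + x * y * (\<beta> - \<alpha>)) * (x * b i + y * c i) -
      (y\<^sup>2 * \<alpha> - 2 * x * y * \<gamma> + x\<^sup>2 * \<beta>) * (- y * b i + x * c i)"
      unfolding sum_mult_combination D(4)[OF i] D(5)[OF i] using one by Groebner_Basis.algebra
  qed (unfold sum_combination_mult D(6-8), (use one in Groebner_Basis.algebra)+)
qed

lemma bordered_idempotent_swap:
  assumes bd: "bordered_idempotent W A b c \<alpha> \<gamma> \<beta>"
  shows "bordered_idempotent W A c b \<beta> \<gamma> \<alpha>"
  using bordered_idempotentD[OF bd] unfolding bordered_idempotent_def
  by (auto simp: algebra_simps)

text \<open>The identity minus a symmetric idempotent is again one. This reflects the eigenvalues of
  the corner at 1/2 and keeps the off-diagonal zero pattern.\<close>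

lemma bordered_idempotent_complement:
  assumes bd: "bordered_idempotent W A b c \<alpha> \<gamma> \<beta>"
  shows "bordered_idempotent W (\<lambda>i j. (if i = j then 1 else 0) - A i j) (\<lambda>i. - b i) (\<lambda>i. - c i)
    (1 - \<alpha>) (- \<gamma>) (1 - \<beta>)"
proof -
  note D = bordered_idempotentD[OF bd]
  have *: "(\<Sum>k\<in>W. ((if i = k then 1 else 0) - A i k) * f k) = f i - (\<Sum>k\<in>W. A i k * f k)"
    if "i \<in> W" for i f
  proof -
    have "((if i = k then 1 else 0) - A i k) * f k = (if i = k then f k else 0) - A i k * f k" for k
      by (simp add: algebra_simps)
    then show ?thesis using D(1) that by (simp add: sum_subtractf)
  qed
  have **: "(\<Sum>k\<in>W. A i k * ((if k = j then 1 else 0) - A k j)) = A i j - (\<Sum>k\<in>W. A i k * A k j)"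
    if "j \<in> W" for i j
  proof -
    have "A i k * ((if k = j then 1 else 0) - A k j) = (if k = j then A i k else 0) - A i k * A k j" for k
      by (simp add: algebra_simps)
    then show ?thesis using D(1) that by (simp add: sum_subtractf)
  qed
  show ?thesis
    unfolding bordered_idempotent_def
  proof (intro conjI ballI D(1))
    fix i j assume ij: "i \<in> W" "j \<in> W"
    show "(if i = j then 1 else 0) - A i j = (if j = i then 1 else 0) - A j i"
      using D(2)[OF ij] by simp
    show "(\<Sum>k\<in>W. ((if i = k then 1 else 0) - A i k) * ((if k = j then 1 else 0) - A k j)) =
        (if i = j then 1 else 0) - A i j - - b i * - b j - - c i * - c j"
      unfolding *[OF ij(1)] **[OF ij(2)] D(3)[OF ij] by simp
  next
    fix i assume i: "i \<in> W"
    show "(\<Sum>k\<in>W. ((if i = k then 1 else 0) - A i k) * - b k) = - b i - (1 - \<alpha>) * - b i - - \<gamma> * - c i"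
      unfolding *[OF i] using D(4)[OF i] by (simp add: sum_negf algebra_simps)
    show "(\<Sum>k\<in>W. ((if i = k then 1 else 0) - A i k) * - c k) = - c i - - \<gamma> * - b i - (1 - \<beta>) * - c i"
      unfolding *[OF i] using D(5)[OF i] by (simp add: sum_negf algebra_simps)
  qed (use D(6-8) in \<open>simp_all add: algebra_simps\<close>)
qed

text \<open>A rotation preserves the squared length of (b, c).\<close>

lemma rotated_row_nonzero:
  fixes b c x y :: real
  assumes "x\<^sup>2 + y\<^sup>2 = 1" "b \<noteq> 0 \<or> c \<noteq> 0"
  shows "x * b + y * c \<noteq> 0 \<or> - y * b + x * c \<noteq> 0"
proof -
  have "(x * b + y * c)\<^sup>2 + (- y * b + x * c)\<^sup>2 = b\<^sup>2 + c\<^sup>2"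
    using assms(1) by Groebner_Basis.algebra
  moreover have "b\<^sup>2 + c\<^sup>2 \<noteq> 0" using assms(2) by (simp add: sum_power2_eq_zero_iff)
  ultimately show ?thesis by auto
qed

text \<open>Rotations are parametrized by their slope \<open>t\<close>, so that conditions on a
  rotation become polynomial conditions on \<open>t\<close>.\<close>

lemma unit_vector_of_slope:
  obtains x y :: real where "x\<^sup>2 + y\<^sup>2 = 1" "x > 0" "y = t * x"
proof
  let ?x = "1 / sqrt (1 + t\<^sup>2)"
  have "1 + t\<^sup>2 > 0" by (simp add: add_pos_nonneg)
  then show "?x > 0" by simp
  show "?x\<^sup>2 + (t * ?x)\<^sup>2 = 1"
    using \<open>1 + t\<^sup>2 > 0\<close> by (simp add: power_mult_distrib power_divide add_divide_distrib[symmetric])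
qed simp

text \<open>A rotation diagonalizes the 2 x 2 corner. Its eigenvalues differ because \<gamma> is
  nonzero, and swapping the two indices puts them in increasing order.\<close>

lemma bordered_idempotent_diagonalize:
  assumes bd: "bordered_idempotent W A b c \<alpha> \<gamma> \<beta>" and \<gamma>: "\<gamma> \<noteq> 0"
    and nz: "\<forall>i\<in>W. b i \<noteq> 0 \<or> c i \<noteq> 0"
  obtains b' c' \<alpha>' \<beta>' where "bordered_idempotent W A b' c' \<alpha>' 0 \<beta>'" "\<alpha>' < \<beta>'"
    "\<forall>i\<in>W. b' i \<noteq> 0 \<or> c' i \<noteq> 0"
proof -
  \<comment> \<open>A root of the quadratic equation for the slope that says that the rotated
    off-diagonal corner entry is zero.\<close>
  define t where "t = ((\<beta> - \<alpha>) + sqrt ((\<beta> - \<alpha>)\<^sup>2 + 4 * \<gamma>\<^sup>2)) / (2 * \<gamma>)"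
  have "2 * \<gamma> * t - (\<beta> - \<alpha>) = sqrt ((\<beta> - \<alpha>)\<^sup>2 + 4 * \<gamma>\<^sup>2)"
    using \<gamma> by (simp add: t_def)
  then have "(2 * \<gamma> * t - (\<beta> - \<alpha>))\<^sup>2 = (\<beta> - \<alpha>)\<^sup>2 + 4 * \<gamma>\<^sup>2"
    by simp
  then have "4 * \<gamma> * ((1 - t\<^sup>2) * \<gamma> + t * (\<beta> - \<alpha>)) = 0"
    by Groebner_Basis.algebra
  then have t: "(1 - t\<^sup>2) * \<gamma> + t * (\<beta> - \<alpha>) = 0"
    using \<gamma> by simp
  obtain x y where xy: "x\<^sup>2 + y\<^sup>2 = 1" "x > 0" "y = t * x"
    by (rule unit_vector_of_slope)
  have zero: "(x\<^sup>2 - y\<^sup>2) * \<gamma> + x * y * (\<beta> - \<alpha>) = 0"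
    using t xy(3) by Groebner_Basis.algebra
  let ?b = "\<lambda>i. x * b i + y * c i" and ?c = "\<lambda>i. - y * b i + x * c i"
  let ?a = "x\<^sup>2 * \<alpha> + 2 * x * y * \<gamma> + y\<^sup>2 * \<beta>" and ?e = "y\<^sup>2 * \<alpha> - 2 * x * y * \<gamma> + x\<^sup>2 * \<beta>"
  have bd': "bordered_idempotent W A ?b ?c ?a 0 ?e"
    using bordered_idempotent_rotate[OF bd xy(1)] unfolding zero .
  \<comment> \<open>The discriminant of the characteristic polynomial of the corner is invariant
    under rotation.\<close>
  have sq: "(?a - ?e)\<^sup>2 = (\<alpha> - \<beta>)\<^sup>2 + 4 * \<gamma>\<^sup>2"
    using zero xy(1) by Groebner_Basis.algebra
  have "(\<alpha> - \<beta>)\<^sup>2 + 4 * \<gamma>\<^sup>2 > 0"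
    using \<gamma> by (simp add: add_nonneg_pos)
  then have "?a \<noteq> ?e"
    unfolding sq[symmetric] zero_less_power2 right_minus_eq .
  moreover have "\<forall>i\<in>W. ?b i \<noteq> 0 \<or> ?c i \<noteq> 0"
    using rotated_row_nonzero[OF xy(1)] nz by blast
  ultimately show ?thesis
    using that[OF bd'] that[OF bordered_idempotent_swap[OF bd']] by (cases "?a < ?e") auto
qed

text \<open>For a rotation of slope \<open>t\<close>, every entry that must be nonzero is a positive
  multiple of a nonzero polynomial in \<open>t\<close>, of degree at most 1 for the border and 2 for
  the corner. A slope outside the finitely many roots works.\<close>

lemma bordered_idempotent_generic_rotation:
  assumes bd: "bordered_idempotent W A b c \<alpha> \<gamma> \<beta>" and \<gamma>: "\<gamma> \<noteq> 0"
    and nz: "\<forall>i\<in>W. b i \<noteq> 0 \<or> c i \<noteq> 0"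
  obtains b' c' \<alpha>' \<gamma>' \<beta>' where "bordered_idempotent W A b' c' \<alpha>' \<gamma>' \<beta>'" "\<gamma>' \<noteq> 0"
    "\<forall>i\<in>W. b' i \<noteq> 0 \<and> c' i \<noteq> 0"
proof -
  let ?P = "\<lambda>i. {t. poly [:b i, c i:] t = 0} \<union> {t. poly [:c i, - b i:] t = 0}"
  let ?Q = "{t. poly [:\<gamma>, \<beta> - \<alpha>, - \<gamma>:] t = 0}"
  have "finite ((\<Union>i\<in>W. ?P i) \<union> ?Q)"
    by (intro finite_UnI finite_UN_I poly_roots_finite bordered_idempotentD(1)[OF bd])
      (use nz \<gamma> in auto)
  then obtain t where t: "t \<notin> (\<Union>i\<in>W. ?P i) \<union> ?Q"
    using ex_new_if_finite infinite_UNIV_char_0 by blast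
  obtain x y where xy: "x\<^sup>2 + y\<^sup>2 = 1" "x > 0" "y = t * x"
    by (rule unit_vector_of_slope)
  have "x * b i + y * c i = x * poly [:b i, c i:] t" "- y * b i + x * c i = x * poly [:c i, - b i:] t"
    "(x\<^sup>2 - y\<^sup>2) * \<gamma> + x * y * (\<beta> - \<alpha>) = x\<^sup>2 * poly [:\<gamma>, \<beta> - \<alpha>, - \<gamma>:] t" for i
    unfolding xy(3) by (simp_all add: algebra_simps power2_eq_square)
  then show ?thesis
    using that[OF bordered_idempotent_rotate[OF bd xy(1)]] t xy(2) by auto
qed

section \<open>Amalgamation\<close>

text \<open>The assumptions are the block entries of the equation "square equals itself" for a
  matrix with diagonal blocks \<open>A\<close>, \<open>B\<close> and off-diagonal block
  \<open>y\<close>. The blocks below the diagonal follow by transposition.\<close>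

lemma bordered_idempotent_join:
  fixes y :: "'a \<Rightarrow> 'a \<Rightarrow> real"
  assumes fin: "finite W1" "finite W2" and disj: "W1 \<inter> W2 = {}"
    and symA: "\<And>i j. i \<in> W1 \<Longrightarrow> j \<in> W1 \<Longrightarrow> A i j = A j i"
    and symB: "\<And>i j. i \<in> W2 \<Longrightarrow> j \<in> W2 \<Longrightarrow> B i j = B j i"
    and e11: "\<And>i j. i \<in> W1 \<Longrightarrow> j \<in> W1 \<Longrightarrow>
      (\<Sum>k\<in>W1. A i k * A k j) + (\<Sum>k\<in>W2. y i k * y j k) = A i j - b1 i * b1 j - c1 i * c1 j"
    and e12: "\<And>i j. i \<in> W1 \<Longrightarrow> j \<in> W2 \<Longrightarrow>
      (\<Sum>k\<in>W1. A i k * y k j) + (\<Sum>k\<in>W2. B j k * y i k) = y i j - b1 i * b2 j - c1 i * c2 j"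
    and e22: "\<And>i j. i \<in> W2 \<Longrightarrow> j \<in> W2 \<Longrightarrow>
      (\<Sum>k\<in>W1. y k i * y k j) + (\<Sum>k\<in>W2. B i k * B k j) = B i j - b2 i * b2 j - c2 i * c2 j"
    and e1b: "\<And>i. i \<in> W1 \<Longrightarrow>
      (\<Sum>k\<in>W1. A i k * b1 k) + (\<Sum>k\<in>W2. y i k * b2 k) = b1 i - \<alpha> * b1 i - \<gamma> * c1 i"
    and e1c: "\<And>i. i \<in> W1 \<Longrightarrow>
      (\<Sum>k\<in>W1. A i k * c1 k) + (\<Sum>k\<in>W2. y i k * c2 k) = c1 i - \<gamma> * b1 i - \<beta> * c1 i"
    and e2b: "\<And>i. i \<in> W2 \<Longrightarrow>
      (\<Sum>k\<in>W1. y k i * b1 k) + (\<Sum>k\<in>W2. B i k * b2 k) = b2 i - \<alpha> * b2 i - \<gamma> * c2 i"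
    and e2c: "\<And>i. i \<in> W2 \<Longrightarrow>
      (\<Sum>k\<in>W1. y k i * c1 k) + (\<Sum>k\<in>W2. B i k * c2 k) = c2 i - \<gamma> * b2 i - \<beta> * c2 i"
    and ebb: "(\<Sum>k\<in>W1. b1 k * b1 k) + (\<Sum>k\<in>W2. b2 k * b2 k) = \<alpha> - \<alpha> * \<alpha> - \<gamma> * \<gamma>"
    and ebc: "(\<Sum>k\<in>W1. b1 k * c1 k) + (\<Sum>k\<in>W2. b2 k * c2 k) = \<gamma> - \<alpha> * \<gamma> - \<gamma> * \<beta>"
    and ecc: "(\<Sum>k\<in>W1. c1 k * c1 k) + (\<Sum>k\<in>W2. c2 k * c2 k) = \<beta> - \<gamma> * \<gamma> - \<beta> * \<beta>"
  shows "bordered_idempotent (W1 \<union> W2)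
    (\<lambda>i j. if i \<in> W1 then (if j \<in> W1 then A i j else y i j) else if j \<in> W1 then y j i else B i j)
    (\<lambda>i. if i \<in> W1 then b1 i else b2 i) (\<lambda>i. if i \<in> W1 then c1 i else c2 i) \<alpha> \<gamma> \<beta>"
    (is "bordered_idempotent _ ?M ?b ?c _ _ _")
proof -
  have notin: "i \<notin> W1" if "i \<in> W2" for i using disj that by auto
  have split: "(\<Sum>k\<in>W1 \<union> W2. F k) = (\<Sum>k\<in>W1. F k) + (\<Sum>k\<in>W2. F k)" for F :: "'a \<Rightarrow> real"
    by (rule sum.union_disjoint[OF fin disj])
  have e21: "(\<Sum>k\<in>W1. y k i * A k j) + (\<Sum>k\<in>W2. B i k * y j k) = y j i - b2 i * b1 j - c2 i * c1 j"
    if "i \<in> W2" "j \<in> W1" for i j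
  proof -
    have "(\<Sum>k\<in>W1. y k i * A k j) = (\<Sum>k\<in>W1. A j k * y k i)"
      using symA that by (auto intro!: sum.cong simp: mult.commute)
    then show ?thesis using e12[OF that(2,1)] by (simp add: mult.commute)
  qed
  have e12': "(\<Sum>k\<in>W1. A i k * y k j) + (\<Sum>k\<in>W2. y i k * B k j) = y i j - b1 i * b2 j - c1 i * c2 j"
    if "i \<in> W1" "j \<in> W2" for i j
  proof -
    have "(\<Sum>k\<in>W2. y i k * B k j) = (\<Sum>k\<in>W2. B j k * y i k)"
      using symB that by (auto intro!: sum.cong simp: mult.commute)
    then show ?thesis using e12[OF that] by simp
  qed
  show ?thesis
    unfolding bordered_idempotent_def split
  proof (intro conjI ballI)
    fix i j assume ij: "i \<in> W1 \<union> W2" "j \<in> W1 \<union> W2"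
    then show "?M i j = ?M j i"
      using symA[of i j] symB[of i j] by auto
    show "(\<Sum>k\<in>W1. ?M i k * ?M k j) + (\<Sum>k\<in>W2. ?M i k * ?M k j) =
        ?M i j - ?b i * ?b j - ?c i * ?c j"
      using ij e11[of i j] e12'[of i j] e21[of i j] e22[of i j] by (auto simp: notin cong: sum.cong)
  next
    fix i assume i: "i \<in> W1 \<union> W2"
    show "(\<Sum>k\<in>W1. ?M i k * ?b k) + (\<Sum>k\<in>W2. ?M i k * ?b k) = ?b i - \<alpha> * ?b i - \<gamma> * ?c i"
      using i e1b[of i] e2b[of i] by (auto simp: notin cong: sum.cong)
    show "(\<Sum>k\<in>W1. ?M i k * ?c k) + (\<Sum>k\<in>W2. ?M i k * ?c k) = ?c i - \<gamma> * ?b i - \<beta> * ?c i"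
      using i e1c[of i] e2c[of i] by (auto simp: notin cong: sum.cong)
  qed (use fin ebb ebc ecc in \<open>simp_all add: notin cong: sum.cong\<close>)
qed

text \<open>The frame spaces are amalgamated along the lines of two distinguished vectors, of squared norms
  \<open>s\<close> and \<open>t\<close>; the defect has rank two, not three, because \<open>s + t = 1\<close>.\<close>

lemma bordered_idempotent_amalgamate_line:
  assumes bdA: "bordered_idempotent W1 A b c s \<sigma> s'" and bdB: "bordered_idempotent W2 B d e t \<tau> t'"
    and disj: "W1 \<inter> W2 = {}" and st: "s + t = 1" and r: "r * r * (s * t) = 1"
  shows "bordered_idempotent (W1 \<union> W2)
    (\<lambda>i j. if i \<in> W1 then (if j \<in> W1 then A i j else r * b i * d j)
      else if j \<in> W1 then r * b j * d i else B i j)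
    (\<lambda>i. if i \<in> W1 then c i else \<sigma> * r * d i) (\<lambda>i. if i \<in> W1 then \<tau> * r * b i else e i)
    s' (\<sigma> * \<tau> * r) t'"
proof -
  note A = bordered_idempotentD[OF bdA] and B = bordered_idempotentD[OF bdB]
  have s2: "(\<Sum>k\<in>W. f k * (p * g k)) = p * (\<Sum>k\<in>W. f k * g k)"
    "(\<Sum>k\<in>W. f k * (p * g k * q)) = p * q * (\<Sum>k\<in>W. f k * g k)"
    "(\<Sum>k\<in>W. p * f k * (q * g k)) = p * q * (\<Sum>k\<in>W. f k * g k)"
    "(\<Sum>k\<in>W. p * f k * g k) = p * (\<Sum>k\<in>W. f k * g k)"
    "(\<Sum>k\<in>W. p * f k * u * (q * g k)) = p * u * q * (\<Sum>k\<in>W. f k * g k)"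
    "(\<Sum>k\<in>W. p * f k * u * g k) = p * u * (\<Sum>k\<in>W. f k * g k)"
    "(\<Sum>k\<in>W. p * f k * u * (q * g k * v)) = p * u * q * v * (\<Sum>k\<in>W. f k * g k)"
    for W :: "'a set" and f g :: "'a \<Rightarrow> real" and p q u v
    by (simp_all add: sum_distrib_left algebra_simps)
  \<comment> \<open>The new border consists of the second distinguished vectors of the two frames,
    and \<open>r\<close> normalizes the identification of the first ones. As 1 - t = s, these
    equations give \<open>r * r * (t - t * t) = 1\<close>, so the other frame supplies the term
    \<open>b i * b j\<close> that is lost with the first vector.\<close>
  note alg = st r
  show ?thesis
  proof (rule bordered_idempotent_join[OF A(1) B(1) disj A(2) B(2)], assumption+)
    fix i j assume ij: "i \<in> W1" "j \<in> W1"
    show "(\<Sum>k\<in>W1. A i k * A k j) + (\<Sum>k\<in>W2. r * b i * d k * (r * b j * d k)) =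
      A i j - c i * c j - \<tau> * r * b i * (\<tau> * r * b j)"
      unfolding s2 A(3)[OF ij] B(6) using alg by Groebner_Basis.algebra
  next
    fix i j assume ij: "i \<in> W1" "j \<in> W2"
    show "(\<Sum>k\<in>W1. A i k * (r * b k * d j)) + (\<Sum>k\<in>W2. B j k * (r * b i * d k)) =
      r * b i * d j - c i * (\<sigma> * r * d j) - \<tau> * r * b i * e j"
      unfolding s2 A(4)[OF ij(1)] B(4)[OF ij(2)] using alg by Groebner_Basis.algebra
  next
    fix i j assume ij: "i \<in> W2" "j \<in> W2"
    show "(\<Sum>k\<in>W1. r * b k * d i * (r * b k * d j)) + (\<Sum>k\<in>W2. B i k * B k j) =
      B i j - \<sigma> * r * d i * (\<sigma> * r * d j) - e i * e j"
      unfolding s2 B(3)[OF ij] A(6) using alg by Groebner_Basis.algebra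
  next
    fix i assume i: "i \<in> W1"
    show "(\<Sum>k\<in>W1. A i k * c k) + (\<Sum>k\<in>W2. r * b i * d k * (\<sigma> * r * d k)) =
      c i - s' * c i - \<sigma> * \<tau> * r * (\<tau> * r * b i)"
      unfolding s2 A(5)[OF i] B(6) using alg by Groebner_Basis.algebra
    show "(\<Sum>k\<in>W1. A i k * (\<tau> * r * b k)) + (\<Sum>k\<in>W2. r * b i * d k * e k) =
      \<tau> * r * b i - \<sigma> * \<tau> * r * c i - t' * (\<tau> * r * b i)"
      unfolding s2 A(4)[OF i] B(7) using alg by Groebner_Basis.algebra
  next
    fix i assume i: "i \<in> W2"
    show "(\<Sum>k\<in>W1. r * b k * d i * c k) + (\<Sum>k\<in>W2. B i k * (\<sigma> * r * d k)) =
      \<sigma> * r * d i - s' * (\<sigma> * r * d i) - \<sigma> * \<tau> * r * e i"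
      unfolding s2 B(4)[OF i] A(7) using alg by Groebner_Basis.algebra
    show "(\<Sum>k\<in>W1. r * b k * d i * (\<tau> * r * b k)) + (\<Sum>k\<in>W2. B i k * e k) =
      e i - \<sigma> * \<tau> * r * (\<sigma> * r * d i) - t' * e i"
      unfolding s2 B(5)[OF i] A(6) using alg by Groebner_Basis.algebra
  next
    show "(\<Sum>k\<in>W1. c k * c k) + (\<Sum>k\<in>W2. \<sigma> * r * d k * (\<sigma> * r * d k)) =
      s' - s' * s' - \<sigma> * \<tau> * r * (\<sigma> * \<tau> * r)"
      unfolding s2 A(8) B(6) using alg by Groebner_Basis.algebra
    have "(\<Sum>k\<in>W1. c k * b k) = (\<Sum>k\<in>W1. b k * c k)" by (simp only: mult.commute)
    then show "(\<Sum>k\<in>W1. c k * (\<tau> * r * b k)) + (\<Sum>k\<in>W2. \<sigma> * r * d k * e k) =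
      \<sigma> * \<tau> * r - s' * (\<sigma> * \<tau> * r) - \<sigma> * \<tau> * r * t'"
      unfolding s2 A(7) B(7) using alg by Groebner_Basis.algebra
    show "(\<Sum>k\<in>W1. \<tau> * r * b k * (\<tau> * r * b k)) + (\<Sum>k\<in>W2. e k * e k) =
      t' - \<sigma> * \<tau> * r * (\<sigma> * \<tau> * r) - t' * t'"
      unfolding s2 A(6) B(8) using alg by Groebner_Basis.algebra
  qed
qed

text \<open>Border rows need only be nonzero as pairs, since a generic rotation later makes both
  entries nonzero. Inside \<open>W1\<close> and \<open>W2\<close> only zero patterns are compared,
  not values, so that the notion does not change when both idempotents are complemented.\<close>

definition amalgamable ::
    "'a set \<Rightarrow> ('a \<Rightarrow> 'a \<Rightarrow> real) \<Rightarrow> 'a set \<Rightarrow> ('a \<Rightarrow> 'a \<Rightarrow> real) \<Rightarrow> bool" where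
  "amalgamable W1 A W2 B \<longleftrightarrow> (\<exists>M b c \<alpha> \<gamma> \<beta>.
     bordered_idempotent (W1 \<union> W2) M b c \<alpha> \<gamma> \<beta> \<and> \<gamma> \<noteq> 0 \<and>
     (\<forall>i\<in>W1 \<union> W2. b i \<noteq> 0 \<or> c i \<noteq> 0) \<and>
     (\<forall>i\<in>W1. \<forall>j\<in>W1. i \<noteq> j \<longrightarrow> (M i j \<noteq> 0 \<longleftrightarrow> A i j \<noteq> 0)) \<and>
     (\<forall>i\<in>W2. \<forall>j\<in>W2. i \<noteq> j \<longrightarrow> (M i j \<noteq> 0 \<longleftrightarrow> B i j \<noteq> 0)) \<and>
     (\<forall>i\<in>W1. \<forall>j\<in>W2. M i j \<noteq> 0))"

text \<open>Rotating the diagonal corner produces any convex combination of \<alpha> and \<beta> as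
  first entry. A strict one makes the off-diagonal entry \<open>x * y * (\<beta> - \<alpha>)\<close>
  nonzero, and the genericity condition excludes \<open>x * b i + y * c i = 0\<close> after
  squaring.\<close>

lemma bordered_idempotent_prescribe_corner:
  assumes bd: "bordered_idempotent W A b c \<alpha> 0 \<beta>" and s: "\<alpha> < s" "s < \<beta>"
    and generic: "\<And>i. i \<in> W \<Longrightarrow> (\<beta> - s) * (b i)\<^sup>2 \<noteq> (s - \<alpha>) * (c i)\<^sup>2"
  obtains b' c' \<gamma>' \<beta>' where "bordered_idempotent W A b' c' s \<gamma>' \<beta>'" "\<gamma>' \<noteq> 0" "\<forall>i\<in>W. b' i \<noteq> 0"
proof -
  define x y where "x = sqrt ((\<beta> - s) / (\<beta> - \<alpha>))" and "y = sqrt ((s - \<alpha>) / (\<beta> - \<alpha>))"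
  have pos: "x > 0" "y > 0" using s by (auto simp: x_def y_def)
  have "x\<^sup>2 = (\<beta> - s) / (\<beta> - \<alpha>)" "y\<^sup>2 = (s - \<alpha>) / (\<beta> - \<alpha>)"
    using s by (simp_all add: x_def y_def)
  then have sq: "x\<^sup>2 * (\<beta> - \<alpha>) = \<beta> - s" "y\<^sup>2 * (\<beta> - \<alpha>) = s - \<alpha>"
    using s by simp_all
  then have "(x\<^sup>2 + y\<^sup>2 - 1) * (\<beta> - \<alpha>) = 0" by (simp add: algebra_simps)
  then have xy: "x\<^sup>2 + y\<^sup>2 = 1" using s by simp
  have corner: "x\<^sup>2 * \<alpha> + 2 * x * y * 0 + y\<^sup>2 * \<beta> = s"
    using sq xy by Groebner_Basis.algebra
  note bd' = bordered_idempotent_rotate[OF bd xy, unfolded corner]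
  have "x * b i + y * c i \<noteq> 0" if "i \<in> W" for i
  proof
    assume "x * b i + y * c i = 0"
    then have "(\<beta> - \<alpha>) * (x\<^sup>2 * (b i)\<^sup>2 - y\<^sup>2 * (c i)\<^sup>2) = 0"
      by Groebner_Basis.algebra
    then have "(\<beta> - s) * (b i)\<^sup>2 = (s - \<alpha>) * (c i)\<^sup>2"
      unfolding sq[symmetric] by (simp add: algebra_simps)
    then show False using generic that by blast
  qed
  then show ?thesis
    using that[OF bd'] pos s by auto
qed

text \<open>The equation is affine in \<open>s\<close>, and the coefficient of \<open>s\<close> is
  the nonzero sum of squares up to sign.\<close>

lemma finite_linear_coincidence:
  fixes b c \<alpha> \<beta> :: real
  assumes "\<alpha> < \<beta>" "b \<noteq> 0 \<or> c \<noteq> 0"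
  shows "finite {s. (\<beta> - s) * b\<^sup>2 = (s - \<alpha>) * c\<^sup>2}"
proof -
  have "b\<^sup>2 + c\<^sup>2 \<noteq> 0" using assms(2) by (simp add: sum_power2_eq_zero_iff)
  then have "{s. (\<beta> - s) * b\<^sup>2 = (s - \<alpha>) * c\<^sup>2} \<subseteq> {(\<beta> * b\<^sup>2 + \<alpha> * c\<^sup>2) / (b\<^sup>2 + c\<^sup>2)}"
    by (auto simp: nonzero_eq_divide_eq algebra_simps)
  then show ?thesis by (rule finite_subset) simp
qed

text \<open>The overlap condition leaves an open interval of values \<open>s\<close> strictly
  between \<alpha>1 and \<alpha>2 for which 1 - s lies strictly between \<beta>1 and \<beta>2. Any
  \<open>s\<close> in it outside a finite set allows gluing along a line.\<close>

lemma amalgamable_overlap: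
  assumes bdA: "bordered_idempotent W1 A b c \<alpha>1 0 \<alpha>2" and nzA: "\<forall>i\<in>W1. b i \<noteq> 0 \<or> c i \<noteq> 0"
    and bdB: "bordered_idempotent W2 B d e \<beta>1 0 \<beta>2" and nzB: "\<forall>i\<in>W2. d i \<noteq> 0 \<or> e i \<noteq> 0"
    and disj: "W1 \<inter> W2 = {}"
    and nonneg: "\<alpha>1 \<ge> 0" "\<beta>1 \<ge> 0" and lt: "\<alpha>1 < \<alpha>2" "\<beta>1 < \<beta>2"
    and overlap: "\<alpha>1 + \<beta>1 < 1" "1 < \<alpha>2 + \<beta>2"
  shows "amalgamable W1 A W2 B"
proof -
  let ?F = "\<lambda>i. {s. (\<alpha>2 - s) * (b i)\<^sup>2 = (s - \<alpha>1) * (c i)\<^sup>2}"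
  \<comment> \<open>The exceptional values of the second frame are reflected because its corner
    receives 1 - s.\<close>
  let ?G = "\<lambda>i. (\<lambda>t. 1 - t) ` {t. (\<beta>2 - t) * (d i)\<^sup>2 = (t - \<beta>1) * (e i)\<^sup>2}"
  have "finite ((\<Union>i\<in>W1. ?F i) \<union> (\<Union>i\<in>W2. ?G i))"
    by (intro finite_UnI finite_UN_I finite_imageI finite_linear_coincidence lt
        bordered_idempotentD(1)[OF bdA] bordered_idempotentD(1)[OF bdB]) (use nzA nzB in auto)
  moreover have "infinite {max \<alpha>1 (1 - \<beta>2)<..<min \<alpha>2 (1 - \<beta>1)}"
    by (rule infinite_Ioo) (use lt overlap in auto)
  ultimately have "infinite ({max \<alpha>1 (1 - \<beta>2)<..<min \<alpha>2 (1 - \<beta>1)} - ((\<Union>i\<in>W1. ?F i) \<union> (\<Union>i\<in>W2. ?G i)))"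
    by (rule Diff_infinite_finite)
  then have "{max \<alpha>1 (1 - \<beta>2)<..<min \<alpha>2 (1 - \<beta>1)} - ((\<Union>i\<in>W1. ?F i) \<union> (\<Union>i\<in>W2. ?G i)) \<noteq> {}"
    by (rule infinite_imp_nonempty)
  then obtain s where "s \<in> {max \<alpha>1 (1 - \<beta>2)<..<min \<alpha>2 (1 - \<beta>1)} - ((\<Union>i\<in>W1. ?F i) \<union> (\<Union>i\<in>W2. ?G i))"
    by (rule ex_in_conv[THEN iffD2, THEN exE])
  then have s: "max \<alpha>1 (1 - \<beta>2) < s" "s < min \<alpha>2 (1 - \<beta>1)"
    and sF: "s \<notin> (\<Union>i\<in>W1. ?F i)" "s \<notin> (\<Union>i\<in>W2. ?G i)"
    unfolding Diff_iff Un_iff greaterThanLessThan_iff by blast+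
  obtain b' c' \<sigma> s' where A': "bordered_idempotent W1 A b' c' s \<sigma> s'" "\<sigma> \<noteq> 0" "\<forall>i\<in>W1. b' i \<noteq> 0"
    by (rule bordered_idempotent_prescribe_corner[OF bdA, of s]) (use s sF(1) in auto)
  obtain d' e' \<tau> t' where B': "bordered_idempotent W2 B d' e' (1 - s) \<tau> t'" "\<tau> \<noteq> 0" "\<forall>i\<in>W2. d' i \<noteq> 0"
  proof (rule bordered_idempotent_prescribe_corner[OF bdB, of "1 - s"])
    show "(\<beta>2 - (1 - s)) * (d i)\<^sup>2 \<noteq> (1 - s - \<beta>1) * (e i)\<^sup>2" if "i \<in> W2" for i
      using sF(2) that by (force simp: image_iff)
  qed (use s in auto)
  \<comment> \<open>Here the lower eigenvalues must be nonnegative: they lie below \<open>s\<close>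
    and 1 - s.\<close>
  have pos: "s * (1 - s) > 0" using s nonneg by auto
  define r where "r = 1 / sqrt (s * (1 - s))"
  have r: "r * r * (s * (1 - s)) = 1" "r \<noteq> 0"
    using pos by (auto simp: r_def)
  have disj': "i \<notin> W1" if "i \<in> W2" for i using disj that by auto
  show ?thesis
    unfolding amalgamable_def
    by (intro exI conjI,
        rule bordered_idempotent_amalgamate_line[OF A'(1) B'(1) disj _ r(1)])
      (use A' B' r disj' in auto)
qed

section \<open>Gluing two frames along a plane\<close>

text \<open>The same in frame coordinates: \<open>P = (p g; g q)\<close> is the frame operator of the two distinguished
  vectors on the plane that they span, and \<open>(x i, y i)\<close> is the projection of the \<open>i\<close>-th vector to
  this plane.\<close>

definition framed_idempotent ::
    "'a set \<Rightarrow> ('a \<Rightarrow> 'a \<Rightarrow> real) \<Rightarrow> ('a \<Rightarrow> real) \<Rightarrow> ('a \<Rightarrow> real) \<Rightarrow> real \<Rightarrow> real \<Rightarrow> real \<Rightarrow> bool" where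
  "framed_idempotent W A x y p g q \<longleftrightarrow> finite W \<and>
     (\<forall>i\<in>W. \<forall>j\<in>W. A i j = A j i) \<and>
     (\<forall>i\<in>W. \<forall>j\<in>W. (\<Sum>k\<in>W. A i k * A k j) =
        A i j - p * x i * x j - g * (x i * y j + y i * x j) - q * y i * y j) \<and>
     (\<forall>i\<in>W. (\<Sum>k\<in>W. A i k * x k) = x i - p * x i - g * y i) \<and>
     (\<forall>i\<in>W. (\<Sum>k\<in>W. A i k * y k) = y i - g * x i - q * y i) \<and>
     (\<Sum>k\<in>W. x k * x k) = 1 - p \<and> (\<Sum>k\<in>W. x k * y k) = - g \<and> (\<Sum>k\<in>W. y k * y k) = 1 - q"

lemma framed_idempotentD:
  assumes "framed_idempotent W A x y p g q"
  shows "finite W"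
    and "i \<in> W \<Longrightarrow> j \<in> W \<Longrightarrow> A i j = A j i"
    and "i \<in> W \<Longrightarrow> j \<in> W \<Longrightarrow> (\<Sum>k\<in>W. A i k * A k j) =
        A i j - p * x i * x j - g * (x i * y j + y i * x j) - q * y i * y j"
    and "i \<in> W \<Longrightarrow> (\<Sum>k\<in>W. A i k * x k) = x i - p * x i - g * y i"
    and "i \<in> W \<Longrightarrow> (\<Sum>k\<in>W. A i k * y k) = y i - g * x i - q * y i"
    and "(\<Sum>k\<in>W. x k * x k) = 1 - p"
    and "(\<Sum>k\<in>W. x k * y k) = - g"
    and "(\<Sum>k\<in>W. y k * y k) = 1 - q"
  using assms unfolding framed_idempotent_def by blast+

text \<open>With a diagonal corner the two distinguished vectors are orthogonal. Normalized, they
  form an orthonormal basis of their plane, in which their frame operator is diagonal.\<close>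

lemma framed_of_bordered:
  assumes bd: "bordered_idempotent W A b c \<alpha> 0 \<beta>" and pos: "\<alpha> > 0" "\<beta> > 0"
  shows "framed_idempotent W A (\<lambda>i. b i / sqrt \<alpha>) (\<lambda>i. c i / sqrt \<beta>) \<alpha> 0 \<beta>"
proof -
  note D = bordered_idempotentD[OF bd]
  define r s where "r = 1 / sqrt \<alpha>" and "s = 1 / sqrt \<beta>"
  have rs: "r * r * \<alpha> = 1" "s * s * \<beta> = 1"
    using pos by (auto simp: r_def s_def)
  \<comment> \<open>The zero coefficients bring both coordinates into the shape of the rules for
    sums of linear combinations.\<close>
  have eq: "b i / sqrt \<alpha> = r * b i + 0 * c i" "c i / sqrt \<beta> = 0 * b i + s * c i" for i
    by (auto simp: r_def s_def)
  show ?thesis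
    unfolding framed_idempotent_def eq
  proof (intro conjI ballI D(1))
    fix i j assume ij: "i \<in> W" "j \<in> W"
    show "A i j = A j i" using D(2) ij .
    show "(\<Sum>k\<in>W. A i k * A k j) = A i j - \<alpha> * (r * b i + 0 * c i) * (r * b j + 0 * c j) -
      0 * ((r * b i + 0 * c i) * (0 * b j + s * c j) + (0 * b i + s * c i) * (r * b j + 0 * c j)) -
      \<beta> * (0 * b i + s * c i) * (0 * b j + s * c j)"
      unfolding D(3)[OF ij] using rs by Groebner_Basis.algebra
  next
    fix i assume i: "i \<in> W"
    show "(\<Sum>k\<in>W. A i k * (r * b k + 0 * c k)) =
      r * b i + 0 * c i - \<alpha> * (r * b i + 0 * c i) - 0 * (0 * b i + s * c i)"
      unfolding sum_mult_combination D(4)[OF i] D(5)[OF i] by Groebner_Basis.algebra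
    show "(\<Sum>k\<in>W. A i k * (0 * b k + s * c k)) =
      0 * b i + s * c i - 0 * (r * b i + 0 * c i) - \<beta> * (0 * b i + s * c i)"
      unfolding sum_mult_combination D(4)[OF i] D(5)[OF i] by Groebner_Basis.algebra
  qed (unfold sum_combination_mult D(6-8), (use rs in \<open>Groebner_Basis.algebra | simp\<close>)+)
qed

text \<open>Only the orthonormal basis of the plane turns, while the frame stays fixed. This is the
  freedom in identifying the planes of two frames.\<close>

lemma framed_idempotent_rotate:
  assumes fr: "framed_idempotent W A x y p g q" and uv: "u\<^sup>2 + v\<^sup>2 = 1"
  shows "framed_idempotent W A (\<lambda>i. u * x i + v * y i) (\<lambda>i. - v * x i + u * y i)
    (u\<^sup>2 * p + 2 * u * v * g + v\<^sup>2 * q) ((u\<^sup>2 - v\<^sup>2) * g + u * v * (q - p))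
    (v\<^sup>2 * p - 2 * u * v * g + u\<^sup>2 * q)"
proof -
  note D = framed_idempotentD[OF fr]
  show ?thesis
    unfolding framed_idempotent_def
  proof (intro conjI ballI D(1))
    fix i j assume ij: "i \<in> W" "j \<in> W"
    show "A i j = A j i" using D(2) ij .
    show "(\<Sum>k\<in>W. A i k * A k j) = A i j -
      (u\<^sup>2 * p + 2 * u * v * g + v\<^sup>2 * q) * (u * x i + v * y i) * (u * x j + v * y j) -
      ((u\<^sup>2 - v\<^sup>2) * g + u * v * (q - p)) *
        ((u * x i + v * y i) * (- v * x j + u * y j) + (- v * x i + u * y i) * (u * x j + v * y j)) -
      (v\<^sup>2 * p - 2 * u * v * g + u\<^sup>2 * q) * (- v * x i + u * y i) * (- v * x j + u * y j)"
      unfolding D(3)[OF ij] using uv by Groebner_Basis.algebra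
  next
    fix i assume i: "i \<in> W"
    show "(\<Sum>k\<in>W. A i k * (u * x k + v * y k)) = u * x i + v * y i -
      (u\<^sup>2 * p + 2 * u * v * g + v\<^sup>2 * q) * (u * x i + v * y i) -
      ((u\<^sup>2 - v\<^sup>2) * g + u * v * (q - p)) * (- v * x i + u * y i)"
      unfolding sum_mult_combination D(4)[OF i] D(5)[OF i] using uv by Groebner_Basis.algebra
    show "(\<Sum>k\<in>W. A i k * (- v * x k + u * y k)) = - v * x i + u * y i -
      ((u\<^sup>2 - v\<^sup>2) * g + u * v * (q - p)) * (u * x i + v * y i) -
      (v\<^sup>2 * p - 2 * u * v * g + u\<^sup>2 * q) * (- v * x i + u * y i)"
      unfolding sum_mult_combination D(4)[OF i] D(5)[OF i] using uv by Groebner_Basis.algebra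
  qed (unfold sum_combination_mult D(6-8), (use uv in \<open>Groebner_Basis.algebra | simp add: algebra_simps power2_eq_square\<close>)+)
qed

text \<open>\<open>D = P + Q - 1\<close> is what two further vectors must contribute to complete the union of the two
  frames to a Parseval frame; its Cholesky factor supplies these vectors.\<close>

lemma framed_idempotent_amalgamate_plane:
  assumes frA: "framed_idempotent W1 A x y p1 g1 q1" and frB: "framed_idempotent W2 B z w p2 g2 q2"
    and disj: "W1 \<inter> W2 = {}"
    and h: "h * h = p1 + p2 - 1" "h * l = g1 + g2" "l * l + m * m = q1 + q2 - 1"
  shows "bordered_idempotent (W1 \<union> W2)
    (\<lambda>i j. if i \<in> W1 then (if j \<in> W1 then A i j else x i * z j + y i * w j)
      else if j \<in> W1 then x j * z i + y j * w i else B i j)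
    (\<lambda>i. if i \<in> W1 then h * x i + l * y i else h * z i + l * w i)
    (\<lambda>i. if i \<in> W1 then 0 * x i + m * y i else 0 * z i + m * w i)
    (h * h + l * l) (l * m) (m * m)"
proof -
  note A = framed_idempotentD[OF frA] and B = framed_idempotentD[OF frB]
  \<comment> \<open>In sums over \<open>W1\<close> the coordinates from \<open>W2\<close> are
    constants, and the rules for linear combinations expect constants in front.\<close>
  have comm: "x i * z j + y i * w j = z j * x i + w j * y i" for i j
    by simp
  show ?thesis
  proof (rule bordered_idempotent_join[OF A(1) B(1) disj A(2) B(2)], assumption+)
    fix i j assume ij: "i \<in> W1" "j \<in> W1"
    show "(\<Sum>k\<in>W1. A i k * A k j) + (\<Sum>k\<in>W2. (x i * z k + y i * w k) * (x j * z k + y j * w k)) =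
      A i j - (h * x i + l * y i) * (h * x j + l * y j) - (0 * x i + m * y i) * (0 * x j + m * y j)"
      unfolding sum_combination_mult A(3)[OF ij] B(6-8) using h by Groebner_Basis.algebra
  next
    fix i j assume ij: "i \<in> W1" "j \<in> W2"
    show "(\<Sum>k\<in>W1. A i k * (x k * z j + y k * w j)) + (\<Sum>k\<in>W2. B j k * (x i * z k + y i * w k)) =
      x i * z j + y i * w j - (h * x i + l * y i) * (h * z j + l * w j) -
      (0 * x i + m * y i) * (0 * z j + m * w j)"
      unfolding comm[of _ j] unfolding sum_mult_combination A(4,5)[OF ij(1)] B(4,5)[OF ij(2)]
      using h by Groebner_Basis.algebra
  next
    fix i j assume ij: "i \<in> W2" "j \<in> W2"
    show "(\<Sum>k\<in>W1. (x k * z i + y k * w i) * (x k * z j + y k * w j)) + (\<Sum>k\<in>W2. B i k * B k j) =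
      B i j - (h * z i + l * w i) * (h * z j + l * w j) - (0 * z i + m * w i) * (0 * z j + m * w j)"
      unfolding comm[of _ i] comm[of _ j] sum_combination_mult B(3)[OF ij] A(6-8)
      using h by Groebner_Basis.algebra
  next
    fix i assume i: "i \<in> W1"
    show "(\<Sum>k\<in>W1. A i k * (h * x k + l * y k)) + (\<Sum>k\<in>W2. (x i * z k + y i * w k) * (h * z k + l * w k)) =
      h * x i + l * y i - (h * h + l * l) * (h * x i + l * y i) - l * m * (0 * x i + m * y i)"
      unfolding sum_combination_mult A(4,5)[OF i] B(6-8) unfolding sum_mult_combination A(4,5)[OF i]
      using h by Groebner_Basis.algebra
    show "(\<Sum>k\<in>W1. A i k * (0 * x k + m * y k)) + (\<Sum>k\<in>W2. (x i * z k + y i * w k) * (0 * z k + m * w k)) =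
      0 * x i + m * y i - l * m * (h * x i + l * y i) - m * m * (0 * x i + m * y i)"
      unfolding sum_combination_mult A(4,5)[OF i] B(6-8) unfolding sum_mult_combination A(4,5)[OF i]
      using h by Groebner_Basis.algebra
  next
    fix i assume i: "i \<in> W2"
    show "(\<Sum>k\<in>W1. (x k * z i + y k * w i) * (h * x k + l * y k)) + (\<Sum>k\<in>W2. B i k * (h * z k + l * w k)) =
      h * z i + l * w i - (h * h + l * l) * (h * z i + l * w i) - l * m * (0 * z i + m * w i)"
      unfolding comm[of _ i] sum_combination_mult A(6-8) unfolding sum_mult_combination B(4,5)[OF i]
      using h by Groebner_Basis.algebra
    show "(\<Sum>k\<in>W1. (x k * z i + y k * w i) * (0 * x k + m * y k)) + (\<Sum>k\<in>W2. B i k * (0 * z k + m * w k)) =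
      0 * z i + m * w i - l * m * (h * z i + l * w i) - m * m * (0 * z i + m * w i)"
      unfolding comm[of _ i] sum_combination_mult A(6-8) unfolding sum_mult_combination B(4,5)[OF i]
      using h by Groebner_Basis.algebra
  qed (unfold sum_combination_mult A(6-8) B(6-8), (use h in Groebner_Basis.algebra)+)
qed

text \<open>For a diagonal corner, \<alpha> - \<alpha> * \<alpha> and \<beta> - \<beta> * \<beta>
  are sums of squares.\<close>

lemma bordered_idempotent_diagonal_bounds:
  assumes "bordered_idempotent W A b c \<alpha> 0 \<beta>"
  shows "0 \<le> \<alpha>" "\<alpha> \<le> 1" "0 \<le> \<beta>" "\<beta> \<le> 1"
proof -
  have unit: "0 \<le> s \<and> s \<le> 1" if "0 \<le> s - s * s" for s :: real
  proof -
    have "0 \<le> s * (1 - s)" using that by (simp add: algebra_simps)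
    then show ?thesis by (auto simp: zero_le_mult_iff)
  qed
  have "(\<Sum>k\<in>W. b k * b k) \<ge> 0" "(\<Sum>k\<in>W. c k * c k) \<ge> 0"
    by (auto intro: sum_nonneg)
  then show "0 \<le> \<alpha>" "\<alpha> \<le> 1" "0 \<le> \<beta>" "\<beta> \<le> 1"
    using unit[of \<alpha>] unit[of \<beta>] bordered_idempotentD(6,8)[OF assms] by auto
qed

text \<open>The coefficients in \<open>t\<close> are the inner product and the determinant of (x i,
  y i) and (z j, w j). Their squares add up to the product of the squared lengths, so no polynomial
  is zero and finitely many slopes are bad.\<close>

lemma generic_slope:
  fixes x y z w :: "'a \<Rightarrow> real"
  assumes fin: "finite W1" "finite W2"
    and nz: "\<forall>i\<in>W1. x i \<noteq> 0 \<or> y i \<noteq> 0" "\<forall>j\<in>W2. z j \<noteq> 0 \<or> w j \<noteq> 0"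
  obtains t where "t \<noteq> 0"
    "\<forall>i\<in>W1. \<forall>j\<in>W2. x i * z j + y i * w j + t * (x i * w j - y i * z j) \<noteq> 0"
proof -
  let ?P = "\<lambda>i j. [:x i * z j + y i * w j, x i * w j - y i * z j:]"
  have "?P i j \<noteq> 0" if "i \<in> W1" "j \<in> W2" for i j
  proof
    assume "?P i j = 0"
    then have "x i * z j + y i * w j = 0" "x i * w j - y i * z j = 0" by auto
    moreover have "(x i * z j + y i * w j)\<^sup>2 + (x i * w j - y i * z j)\<^sup>2 =
        ((x i)\<^sup>2 + (y i)\<^sup>2) * ((z j)\<^sup>2 + (w j)\<^sup>2)"
      by (simp add: algebra_simps power2_eq_square)
    ultimately show False
      using nz that by (auto simp: sum_power2_eq_zero_iff)
  qed
  then have "finite ({0} \<union> (\<Union>i\<in>W1. \<Union>j\<in>W2. {t. poly (?P i j) t = 0}))"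
    by (intro finite_UnI finite_UN_I poly_roots_finite fin) auto
  then obtain t where "t \<notin> {0} \<union> (\<Union>i\<in>W1. \<Union>j\<in>W2. {t. poly (?P i j) t = 0})"
    using ex_new_if_finite infinite_UNIV_char_0 by blast
  then show ?thesis
    using that[of t] by auto
qed

lemma cholesky_2x2:
  fixes a g d :: real
  assumes "a > 0" "a * d > g\<^sup>2"
  obtains h l m where "h * h = a" "h * l = g" "l * l + m * m = d" "h > 0" "m > 0"
proof (rule that[of "sqrt a" "g / sqrt a" "sqrt (d - g\<^sup>2 / a)"])
  have "d - g\<^sup>2 / a > 0"
    using assms by (simp add: field_simps)
  then show "sqrt (d - g\<^sup>2 / a) > 0"
    "g / sqrt a * (g / sqrt a) + sqrt (d - g\<^sup>2 / a) * sqrt (d - g\<^sup>2 / a) = d"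
    using assms(1) by (simp_all add: power2_eq_square)
qed (use assms in auto)

text \<open>The sum of the two frame operators minus the identity is positive semidefinite when the
  lower eigenvalues add up to at least 1. A nontrivial rotation of one plane makes it positive
  definite even in case of equality, and its Cholesky factor gives the new pair.\<close>

lemma amalgamable_above:
  assumes bdA: "bordered_idempotent W1 A b c \<alpha>1 0 \<alpha>2" and nzA: "\<forall>i\<in>W1. b i \<noteq> 0 \<or> c i \<noteq> 0"
    and bdB: "bordered_idempotent W2 B d e \<beta>1 0 \<beta>2" and nzB: "\<forall>i\<in>W2. d i \<noteq> 0 \<or> e i \<noteq> 0"
    and disj: "W1 \<inter> W2 = {}"
    and lt: "\<alpha>1 < \<alpha>2" "\<beta>1 < \<beta>2" and above: "1 \<le> \<alpha>1 + \<beta>1"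
  shows "amalgamable W1 A W2 B"
proof -
  have pos: "\<alpha>1 > 0" "\<alpha>2 > 0" "\<beta>1 > 0" "\<beta>2 > 0"
    using bordered_idempotent_diagonal_bounds[OF bdA] bordered_idempotent_diagonal_bounds[OF bdB]
      lt above by linarith+
  define x y z w where "x i = b i / sqrt \<alpha>1" and "y i = c i / sqrt \<alpha>2"
    and "z i = d i / sqrt \<beta>1" and "w i = e i / sqrt \<beta>2" for i
  have frA: "framed_idempotent W1 A x y \<alpha>1 0 \<alpha>2"
    using framed_of_bordered[OF bdA pos(1,2)] by (simp add: x_def[abs_def] y_def[abs_def])
  have frB: "framed_idempotent W2 B z w \<beta>1 0 \<beta>2"
    using framed_of_bordered[OF bdB pos(3,4)] by (simp add: z_def[abs_def] w_def[abs_def])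
  have nzx: "\<forall>i\<in>W1. x i \<noteq> 0 \<or> y i \<noteq> 0" and nzz: "\<forall>i\<in>W2. z i \<noteq> 0 \<or> w i \<noteq> 0"
    using nzA nzB pos by (auto simp: x_def y_def z_def w_def)
  obtain t where t: "t \<noteq> 0"
    and cross: "\<forall>i\<in>W1. \<forall>j\<in>W2. x i * z j + y i * w j + t * (x i * w j - y i * z j) \<noteq> 0"
    by (rule generic_slope[OF framed_idempotentD(1)[OF frA] framed_idempotentD(1)[OF frB] nzx nzz])
  obtain u v where uv: "u\<^sup>2 + v\<^sup>2 = 1" "u > 0" "v = t * u"
    by (rule unit_vector_of_slope)
  define z' w' where "z' i = u * z i + v * w i" and "w' i = - v * z i + u * w i" for i
  let ?p = "u\<^sup>2 * \<beta>1 + v\<^sup>2 * \<beta>2" and ?g = "u * v * (\<beta>2 - \<beta>1)" and ?q = "v\<^sup>2 * \<beta>1 + u\<^sup>2 * \<beta>2"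
  have frB': "framed_idempotent W2 B z' w' ?p ?g ?q"
    using framed_idempotent_rotate[OF frB uv(1)] by (simp add: z'_def[abs_def] w'_def[abs_def])
  \<comment> \<open>The excess over 1 and the two spectral gaps, in terms of which the positivity of
    the defect is visible; only \<kappa> may be zero.\<close>
  define \<kappa> \<delta> \<eta> where "\<kappa> = \<alpha>1 + \<beta>1 - 1" and "\<delta> = \<beta>2 - \<beta>1" and "\<eta> = \<alpha>2 - \<alpha>1"
  have signs: "\<kappa> \<ge> 0" "\<delta> > 0" "\<eta> > 0" "v\<^sup>2 > 0"
    using above lt t uv by (auto simp: \<kappa>_def \<delta>_def \<eta>_def)
  have p: "\<alpha>1 + ?p - 1 = \<kappa> + v\<^sup>2 * \<delta>" and q: "\<alpha>2 + ?q - 1 = \<eta> + \<kappa> + u\<^sup>2 * \<delta>"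
    unfolding \<kappa>_def \<delta>_def \<eta>_def using uv(1) by Groebner_Basis.algebra+
  have ppos: "\<alpha>1 + ?p - 1 > 0"
    unfolding p using signs by (simp add: add_nonneg_pos)
  have "?g\<^sup>2 = v\<^sup>2 * \<delta> * (u\<^sup>2 * \<delta>)"
    by (simp add: \<delta>_def power2_eq_square)
  \<comment> \<open>Strict because the gap \<eta> is positive and \<open>v\<close> is
    nonzero.\<close>
  also have "\<dots> < v\<^sup>2 * \<delta> * (\<eta> + \<kappa> + u\<^sup>2 * \<delta>)"
    using signs by (intro mult_strict_left_mono) auto
  also have "\<dots> \<le> (\<kappa> + v\<^sup>2 * \<delta>) * (\<eta> + \<kappa> + u\<^sup>2 * \<delta>)"
    using signs by (intro mult_right_mono) auto
  finally have det: "?g\<^sup>2 < (\<alpha>1 + ?p - 1) * (\<alpha>2 + ?q - 1)"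
    unfolding p q .
  obtain h l m where hlm: "h * h = \<alpha>1 + ?p - 1" "h * l = ?g" "l * l + m * m = \<alpha>2 + ?q - 1"
    "h > 0" "m > 0"
    by (rule cholesky_2x2[OF ppos det])
  \<comment> \<open>The nontrivial rotation makes the defect non-diagonal. Hence \<open>l\<close> is
    nonzero, and so is the corner entry \<open>l * m\<close>.\<close>
  have "?g \<noteq> 0" using uv t lt by auto
  then have l: "l \<noteq> 0" using hlm(2) by auto
  have glue: "h * l = 0 + ?g" using hlm(2) by simp
  have disj': "i \<notin> W1" if "i \<in> W2" for i using disj that by auto
  have nzz': "z' i \<noteq> 0 \<or> w' i \<noteq> 0" if "i \<in> W2" for i
    using rotated_row_nonzero[OF uv(1)] nzz that unfolding z'_def w'_def by blast
  have "x i * z' j + y i * w' j = u * (x i * z j + y i * w j + t * (x i * w j - y i * z j))" for i j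
    by (simp add: z'_def w'_def uv(3) algebra_simps)
  then have cross': "x i * z' j + y i * w' j \<noteq> 0" if "i \<in> W1" "j \<in> W2" for i j
    using cross that uv(2) by simp
  show ?thesis
    unfolding amalgamable_def
    by (intro exI conjI,
        rule framed_idempotent_amalgamate_plane[OF frA frB' disj hlm(1) glue hlm(3)])
      (use hlm(4,5) l nzx nzz' disj' cross' in auto)
qed

lemma bordered_idempotents_amalgamable:
  assumes bdA: "bordered_idempotent W1 A b c \<alpha> \<gamma> \<alpha>'" "\<gamma> \<noteq> 0" and nzA: "\<forall>i\<in>W1. b i \<noteq> 0 \<or> c i \<noteq> 0"
    and bdB: "bordered_idempotent W2 B d e \<beta> \<delta> \<beta>'" "\<delta> \<noteq> 0" and nzB: "\<forall>i\<in>W2. d i \<noteq> 0 \<or> e i \<noteq> 0"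
    and disj: "W1 \<inter> W2 = {}"
  shows "amalgamable W1 A W2 B"
proof -
  obtain b' c' \<alpha>1 \<alpha>2 where A: "bordered_idempotent W1 A b' c' \<alpha>1 0 \<alpha>2" "\<alpha>1 < \<alpha>2"
    "\<forall>i\<in>W1. b' i \<noteq> 0 \<or> c' i \<noteq> 0"
    by (rule bordered_idempotent_diagonalize[OF bdA nzA])
  obtain d' e' \<beta>1 \<beta>2 where B: "bordered_idempotent W2 B d' e' \<beta>1 0 \<beta>2" "\<beta>1 < \<beta>2"
    "\<forall>i\<in>W2. d' i \<noteq> 0 \<or> e' i \<noteq> 0"
    by (rule bordered_idempotent_diagonalize[OF bdB nzB])
  consider "1 \<le> \<alpha>1 + \<beta>1" | "\<alpha>1 + \<beta>1 < 1" "1 < \<alpha>2 + \<beta>2" | "\<alpha>2 + \<beta>2 \<le> 1"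
    by linarith
  then show ?thesis
  proof cases
    case 1
    then show ?thesis by (rule amalgamable_above[OF A(1,3) B(1,3) disj A(2) B(2)])
  next
    case 2
    show ?thesis
      by (rule amalgamable_overlap[OF A(1,3) B(1,3) disj _ _ A(2) B(2) 2])
        (use bordered_idempotent_diagonal_bounds[OF A(1)] bordered_idempotent_diagonal_bounds[OF B(1)] in auto)
  next
    case 3
    let ?C = "\<lambda>A i j. (if i = j then 1 else 0) - A i j :: real"
    \<comment> \<open>Complementing turns the eigenvalues into 1 minus themselves and reverses their
      order, which the swap restores; the lower ones now add up to at least 1.\<close>
    note A' = bordered_idempotent_swap[OF bordered_idempotent_complement[OF A(1)]]
      and B' = bordered_idempotent_swap[OF bordered_idempotent_complement[OF B(1)]]
    have "amalgamable W1 (?C A) W2 (?C B)"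
      by (rule amalgamable_above[OF A'[simplified] _ B'[simplified] _ disj]) (use A B 3 in auto)
    then show ?thesis
      unfolding amalgamable_def by (simp cong: conj_cong)
  qed
qed

section \<open>From amalgamated idempotents to graph patterns\<close>

lemma finite_complete_edges: "finite W \<Longrightarrow> finite (complete_edges W)"
  by (rule finite_subset[of _ "Pow W"]) (auto simp: complete_edges_def)

lemma has_pattern_complete_minus:
  "has_pattern V (complete_edges V - F) p \<longleftrightarrow>
    (\<forall>i\<in>V. \<forall>j\<in>V. i \<noteq> j \<longrightarrow> (p i j \<noteq> 0 \<longleftrightarrow> {i, j} \<notin> F))"
  unfolding has_pattern_def complete_edges_def by auto

text \<open>No deleted edge meets \<open>u\<close> or \<open>v\<close>. So in both given idempotents
  the corner entry at (u, v) and all border entries are nonzero, which is what amalgamation asks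
  for.\<close>

lemma idempotent_pattern_amalgam:
  assumes fin: "finite W1" "finite W2" and disj: "W1 \<inter> W2 = {}"
    and uv: "u \<notin> W1 \<union> W2" "v \<notin> W1 \<union> W2" "u \<noteq> v"
    and F: "F1 \<subseteq> complete_edges W1" "F2 \<subseteq> complete_edges W2"
    and p1: "symmetric_idempotent (insert u (insert v W1)) p1"
      "has_pattern (insert u (insert v W1)) (complete_edges (insert u (insert v W1)) - F1) p1"
    and p2: "symmetric_idempotent (insert u (insert v W2)) p2"
      "has_pattern (insert u (insert v W2)) (complete_edges (insert u (insert v W2)) - F2) p2"
  defines "V \<equiv> insert u (insert v (W1 \<union> W2))"
  shows "\<exists>p. symmetric_idempotent V p \<and> has_pattern V (complete_edges V - (F1 \<union> F2)) p"
proof -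
  have uvi: "u \<notin> W1" "v \<notin> W1" "u \<notin> W2" "v \<notin> W2" using uv by auto
  have sub: "e \<subseteq> W1" if "e \<in> F1" for e using F that by (auto simp: complete_edges_def)
  have sub2: "e \<subseteq> W2" if "e \<in> F2" for e using F that by (auto simp: complete_edges_def)
  have A: "bordered_idempotent W1 p1 (\<lambda>i. p1 i u) (\<lambda>i. p1 i v) (p1 u u) (p1 u v) (p1 v v)"
    by (rule bordered_of_symmetric_idempotent[OF fin(1) uvi(1,2) uv(3) p1(1)])
  have B: "bordered_idempotent W2 p2 (\<lambda>i. p2 i u) (\<lambda>i. p2 i v) (p2 u u) (p2 u v) (p2 v v)"
    by (rule bordered_of_symmetric_idempotent[OF fin(2) uvi(3,4) uv(3) p2(1)])
  have pat1: "p1 i j \<noteq> 0 \<longleftrightarrow> {i, j} \<notin> F1"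
    if "i \<in> insert u (insert v W1)" "j \<in> insert u (insert v W1)" "i \<noteq> j" for i j
    using p1(2) that unfolding has_pattern_complete_minus by blast
  have pat2: "p2 i j \<noteq> 0 \<longleftrightarrow> {i, j} \<notin> F2"
    if "i \<in> insert u (insert v W2)" "j \<in> insert u (insert v W2)" "i \<noteq> j" for i j
    using p2(2) that unfolding has_pattern_complete_minus by blast
  have "amalgamable W1 p1 W2 p2"
  proof (rule bordered_idempotents_amalgamable[OF A _ _ B _ _ disj])
    show "p1 u v \<noteq> 0" using pat1[of u v] sub[of "{u, v}"] uv(3) uvi by auto
    show "p2 u v \<noteq> 0" using pat2[of u v] sub2[of "{u, v}"] uv(3) uvi by auto
    show "\<forall>i\<in>W1. p1 i u \<noteq> 0 \<or> p1 i v \<noteq> 0"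
    proof
      fix i assume i: "i \<in> W1"
      then have "i \<noteq> u" using uvi by auto
      then show "p1 i u \<noteq> 0 \<or> p1 i v \<noteq> 0" using pat1[of i u] sub[of "{i, u}"] i uvi by auto
    qed
    show "\<forall>i\<in>W2. p2 i u \<noteq> 0 \<or> p2 i v \<noteq> 0"
    proof
      fix i assume i: "i \<in> W2"
      then have "i \<noteq> u" using uvi by auto
      then show "p2 i u \<noteq> 0 \<or> p2 i v \<noteq> 0" using pat2[of i u] sub2[of "{i, u}"] i uvi by auto
    qed
  qed
  then obtain M b c \<alpha> \<gamma> \<beta> where bd: "bordered_idempotent (W1 \<union> W2) M b c \<alpha> \<gamma> \<beta>" "\<gamma> \<noteq> 0"
    "\<forall>i\<in>W1 \<union> W2. b i \<noteq> 0 \<or> c i \<noteq> 0"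
    and M1: "\<forall>i\<in>W1. \<forall>j\<in>W1. i \<noteq> j \<longrightarrow> (M i j \<noteq> 0 \<longleftrightarrow> p1 i j \<noteq> 0)"
    and M2: "\<forall>i\<in>W2. \<forall>j\<in>W2. i \<noteq> j \<longrightarrow> (M i j \<noteq> 0 \<longleftrightarrow> p2 i j \<noteq> 0)"
    and M12: "\<forall>i\<in>W1. \<forall>j\<in>W2. M i j \<noteq> 0"
    unfolding amalgamable_def by (elim exE conjE) (rule that)
  \<comment> \<open>Since \<open>u\<close> and \<open>v\<close> must be adjacent to all other
    vertices and to each other, both border columns and the corner entry have to be nonzero
    everywhere.\<close>
  obtain b' c' \<alpha>' \<gamma>' \<beta>' where bd': "bordered_idempotent (W1 \<union> W2) M b' c' \<alpha>' \<gamma>' \<beta>'" "\<gamma>' \<noteq> 0"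
    "\<forall>i\<in>W1 \<union> W2. b' i \<noteq> 0 \<and> c' i \<noteq> 0"
    by (rule bordered_idempotent_generic_rotation[OF bd])
  obtain p where p: "symmetric_idempotent V p" "\<forall>i\<in>W1 \<union> W2. \<forall>j\<in>W1 \<union> W2. p i j = M i j"
    "\<forall>i\<in>W1 \<union> W2. p i u = b' i \<and> p u i = b' i \<and> p i v = c' i \<and> p v i = c' i"
    "p u v = \<gamma>'" "p v u = \<gamma>'"
    using symmetric_idempotent_of_bordered[OF bd'(1) uv, folded V_def]
    by (elim exE conjE) (rule that)
  have "p i j \<noteq> 0 \<longleftrightarrow> {i, j} \<notin> F1 \<union> F2" if ij: "i \<in> V" "j \<in> V" "i \<noteq> j" for i j
  proof (cases "i \<in> W1 \<union> W2 \<and> j \<in> W1 \<union> W2")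
    case True
    then have pM: "p i j = M i j" using p(2) by blast
    consider "i \<in> W1" "j \<in> W1" | "i \<in> W2" "j \<in> W2" | "i \<in> W1" "j \<in> W2" | "i \<in> W2" "j \<in> W1"
      using True by blast
    then show ?thesis
    proof cases
      case 1
      then have "{i, j} \<notin> F2" using sub2 disj by blast
      then show ?thesis using 1 M1 pat1[of i j] ij(3) pM by simp
    next
      case 2
      then have "{i, j} \<notin> F1" using sub disj by blast
      then show ?thesis using 2 M2 pat2[of i j] ij(3) pM by simp
    next
      case 3
      then have "{i, j} \<notin> F1 \<union> F2" using sub sub2 disj by blast
      then show ?thesis using M12 3 pM by simp
    next
      case 4
      then have "{i, j} \<notin> F1 \<union> F2" using sub sub2 disj by blast
      moreover have "M i j = M j i"
        by (rule bordered_idempotentD(2)[OF bd(1)]) (use 4 in auto)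
      ultimately show ?thesis using M12 4 pM by simp
    qed
  next
    case False
    then have "{i, j} \<notin> F1 \<union> F2" using sub sub2 by blast
    moreover have "p i j \<noteq> 0"
      using False ij p(3-5) bd'(2,3) unfolding V_def by auto
    ultimately show ?thesis by simp
  qed
  then show ?thesis using p(1) unfolding has_pattern_complete_minus by blast
qed

lemma bij_image_complete_edges:
  assumes "bij_betw f V U"
  shows "(`) f ` complete_edges V = complete_edges U"
proof -
  have inj: "inj_on f V" and U: "U = f ` V" using assms by (auto simp: bij_betw_def)
  have card: "card (f ` e) = card e" if "e \<subseteq> V" for e
    using inj_on_subset[OF inj that] by (rule card_image)
  show ?thesis
  proof (intro equalityI subsetI)
    fix d assume "d \<in> (`) f ` complete_edges V"
    then show "d \<in> complete_edges U"
      using card by (auto simp: complete_edges_def U)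
  next
    fix d assume "d \<in> complete_edges U"
    then have d: "d \<subseteq> f ` V" "card d = 2" by (auto simp: complete_edges_def U)
    then obtain e where "e \<subseteq> V" "d = f ` e" by (meson subset_imageE)
    then show "d \<in> (`) f ` complete_edges V"
      using d card[of e] by (auto simp: complete_edges_def)
  qed
qed

text \<open>The assumption on q concerns graphs on initial segments of the naturals. A numbering of
  \<open>V\<close> moves the graph there, and the resulting idempotent is pulled back.\<close>

lemma idempotent_pattern_of_small_graphs:
  fixes F :: "'a set set"
  assumes V: "finite V" "card V = m" and m: "3 \<le> m" and F: "F \<subseteq> complete_edges V" "card F \<le> m - 3"
    and q: "\<And>E. simple_graph {0..<m} E \<Longrightarrow> card (complement_edges {0..<m} E) \<le> m - 3 \<Longrightarrow> q_graph m E = 2"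
  shows "\<exists>p. symmetric_idempotent V p \<and> has_pattern V (complete_edges V - F) p"
proof -
  obtain f where f: "bij_betw f V {0..<m}"
    using ex_bij_betw_finite_nat[OF V(1)] V(2) by blast
  let ?E = "(`) f ` (complete_edges V - F)"
  note img = bij_image_complete_edges[OF f]
  have "finite (complete_edges V)"
    by (rule finite_complete_edges) (simp add: V)
  then have finF: "finite F" using F(1) finite_subset by blast
  \<comment> \<open>An inclusion suffices for an upper bound on the number of missing edges.\<close>
  have "complement_edges {0..<m} ?E \<subseteq> (`) f ` F"
    unfolding complement_edges_def img[symmetric] by blast
  then have "card (complement_edges {0..<m} ?E) \<le> card F"
    using finF by (rule surj_card_le[rotated])
  moreover have "simple_graph {0..<m} ?E"
    unfolding simple_graph_def using img by auto
  ultimately have "q_graph m ?E = 2"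
    using q F(2) by simp
  then obtain p where "symmetric_idempotent {0..<m} p" "has_pattern {0..<m} ?E p"
    using idempotent_of_q_graph_2 by blast
  moreover have "complete_edges V - F \<subseteq> Pow V"
    by (auto simp: complete_edges_def)
  ultimately show ?thesis
    using idempotent_transport[OF f] by blast
qed

section \<open>Splitting a sparse graph\<close>

text \<open>If all degrees were at least 2, counting incidences twice would give at least as many
  edges as vertices.\<close>

lemma low_degree_vertex:
  assumes W: "finite W" and F: "F \<subseteq> complete_edges W" and lt: "card F < card W"
  obtains x where "x \<in> W" "card {e \<in> F. x \<in> e} \<le> 1"
proof (rule ccontr)
  assume "\<not> thesis"
  then have deg: "2 \<le> card {e \<in> F. x \<in> e}" if "x \<in> W" for x
    using that \<open>x \<in> W\<close> \<open>\<And>x. x \<in> W \<Longrightarrow> card {e \<in> F. x \<in> e} \<le> 1 \<Longrightarrow> thesis\<close> by fastforce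
  have "finite (complete_edges W)"
    by (rule finite_complete_edges) (simp add: W)
  then have finF: "finite F" using F finite_subset by blast
  have "{x \<in> W. x \<in> e} = e \<and> card e = 2" if "e \<in> F" for e
    using F that by (auto simp: complete_edges_def)
  then have "(\<Sum>x\<in>W. card {e \<in> F. x \<in> e}) = (\<Sum>e\<in>F. 2)"
    by (intro sum_multicount_gen W finF) auto
  moreover have "(\<Sum>x\<in>W. 2) \<le> (\<Sum>x\<in>W. card {e \<in> F. x \<in> e})"
    by (intro sum_mono deg)
  ultimately show False using lt by simp
qed

text \<open>Fewer edges than vertices on a side of size k means at most (k + 2) - 3 edges, the
  number allowed once two further vertices are adjoined.\<close>

definition sparse_split :: "'a set \<Rightarrow> 'a set set \<Rightarrow> 'a set \<Rightarrow> 'a set \<Rightarrow> bool" where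
  "sparse_split W F W1 W2 \<longleftrightarrow> W = W1 \<union> W2 \<and> W1 \<inter> W2 = {} \<and> W1 \<noteq> {} \<and> W2 \<noteq> {} \<and>
     F \<subseteq> complete_edges W1 \<union> complete_edges W2 \<and>
     card (F \<inter> complete_edges W1) < card W1 \<and> card (F \<inter> complete_edges W2) < card W2"

lemma sparse_split_commute: "sparse_split W F W1 W2 \<Longrightarrow> sparse_split W F W2 W1"
  unfolding sparse_split_def by blast

text \<open>A leaf joins the side of its neighbour: that side gains one vertex and at most one edge,
  and the new edge does not cross.\<close>

lemma sparse_split_add_leaf:
  assumes split: "sparse_split W F W1 W2" and W: "finite W" and x: "x \<notin> W" and y: "y \<in> W1"
  shows "sparse_split (insert x W) (insert {x, y} F) (insert x W1) W2"
proof -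
  have S: "W = W1 \<union> W2" "W1 \<inter> W2 = {}" "W2 \<noteq> {}" "F \<subseteq> complete_edges W1 \<union> complete_edges W2"
    "card (F \<inter> complete_edges W1) < card W1" "card (F \<inter> complete_edges W2) < card W2"
    using split unfolding sparse_split_def by auto
  have x': "x \<notin> W1" "x \<notin> W2" "x \<noteq> y" using x S(1) y by auto
  have fin: "finite W1" "finite W2" using W S(1) by auto
  have "finite (complete_edges W1)"
    by (rule finite_complete_edges) (simp add: fin)
  then have fin1: "finite (F \<inter> complete_edges W1)" by simp
  have xy: "{x, y} \<in> complete_edges (insert x W1)" "{x, y} \<notin> complete_edges W2"
    using x' y by (auto simp: complete_edges_def)
  have F2: "insert {x, y} F \<inter> complete_edges W2 = F \<inter> complete_edges W2"
    using xy by auto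
  have "insert {x, y} F \<inter> complete_edges (insert x W1) \<subseteq> insert {x, y} (F \<inter> complete_edges W1)"
  proof
    fix e assume e: "e \<in> insert {x, y} F \<inter> complete_edges (insert x W1)"
    show "e \<in> insert {x, y} (F \<inter> complete_edges W1)"
    proof (cases "e = {x, y}")
      case False
      then have "e \<in> F" "e \<subseteq> insert x W1" "card e = 2" using e by (auto simp: complete_edges_def)
      moreover have "e \<notin> complete_edges W2"
      proof
        assume "e \<in> complete_edges W2"
        then have "e \<subseteq> {}" using \<open>e \<subseteq> insert x W1\<close> x' S(2) by (auto simp: complete_edges_def)
        then show False using \<open>card e = 2\<close> by simp
      qed
      ultimately show ?thesis using S(4) by auto
    qed simp
  qed
  then have "card (insert {x, y} F \<inter> complete_edges (insert x W1)) \<le> card (insert {x, y} (F \<inter> complete_edges W1))"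
    by (intro card_mono) (use fin1 in auto)
  also have "\<dots> \<le> Suc (card (F \<inter> complete_edges W1))" by (simp add: card_insert_if fin1)
  also have "\<dots> < card (insert x W1)" using S(5) x' fin by simp
  finally show ?thesis
    unfolding sparse_split_def F2 using S x' xy by (auto simp: complete_edges_def)
qed

text \<open>Induction by removing a vertex of degree at most 1. The surplus of two vertices over
  edges leaves a surplus of one for each side.\<close>

lemma sparse_split_exists:
  assumes "finite W" "card W = n + 2" "F \<subseteq> complete_edges W" "card F \<le> n"
  shows "\<exists>W1 W2. sparse_split W F W1 W2"
  using assms
proof (induction n arbitrary: W F rule: less_induct)
  case (less n)
  have "finite (complete_edges W)"
    by (rule finite_complete_edges) (simp add: less.prems)
  then have finF: "finite F" using less.prems(3) finite_subset by blast
  obtain x where x: "x \<in> W" and deg: "card {e \<in> F. x \<in> e} \<le> 1"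
    by (rule low_degree_vertex[OF less.prems(1,3)]) (use less.prems in auto)
  have W': "finite (W - {x})" "card (W - {x}) = n + 1" using less.prems x by auto
  have fin': "finite {e \<in> F. x \<in> e}" using finF by simp
  consider "card {e \<in> F. x \<in> e} = 0" | "card {e \<in> F. x \<in> e} = 1"
    using deg by linarith
  then show ?case
  proof cases
    case 1
    \<comment> \<open>An isolated vertex is a side of its own; the other side has n + 1 vertices and
      at most n edges.\<close>
    then have "{e \<in> F. x \<in> e} = {}" using fin' by simp
    then have F: "F \<subseteq> complete_edges (W - {x})"
      using less.prems(3) by (auto simp: complete_edges_def)
    have "W - {x} \<noteq> {}"
    proof
      assume "W - {x} = {}"
      then show False using W'(2) by (simp only: card.empty)
    qed
    moreover have "complete_edges {x} = {}"
      by (auto simp: complete_edges_def subset_singleton_iff)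
    ultimately have "sparse_split W F {x} (W - {x})"
      unfolding sparse_split_def using F W' x less.prems(4) by (auto simp: Int_absorb2)
    then show ?thesis by blast
  next
    case 2
    then obtain e where "{e \<in> F. x \<in> e} = {e}" by (rule card_1_singletonE)
    then have e: "e \<in> F" "x \<in> e" and only: "\<And>d. d \<in> F \<Longrightarrow> x \<in> d \<Longrightarrow> d = e" by auto
    have "e \<subseteq> W" "card e = 2" using e(1) less.prems(3) by (auto simp: complete_edges_def)
    moreover from this obtain a b where ab: "e = {a, b}" "a \<noteq> b"
      by (auto simp: card_2_iff)
    moreover define y where "y = (if x = a then b else a)"
    ultimately have y: "e = {x, y}" "x \<noteq> y"
      using e(2) by auto
    have yW: "y \<in> W - {x}" using y \<open>e \<subseteq> W\<close> by auto
    have "card F > 0" using e(1) finF by (auto simp: card_gt_0_iff)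
    then have n: "n > 0" using less.prems(4) by simp
    \<comment> \<open>Removing the leaf with its edge lowers both counts by one, so the surplus
      persists.\<close>
    have "\<exists>W1 W2. sparse_split (W - {x}) (F - {e}) W1 W2"
    proof (rule less.IH[of "n - 1"])
      show "F - {e} \<subseteq> complete_edges (W - {x})"
        using only less.prems(3) by (auto simp: complete_edges_def)
      show "card (F - {e}) \<le> n - 1" using e(1) less.prems(4) by simp
    qed (use n W' in auto)
    then obtain W1 W2 where s: "sparse_split (W - {x}) (F - {e}) W1 W2" "y \<in> W1"
      using sparse_split_commute yW unfolding sparse_split_def by (metis (no_types, lifting) Un_iff)
    have "sparse_split (insert x (W - {x})) (insert {x, y} (F - {e})) (insert x W1) W2"
      by (rule sparse_split_add_leaf[OF s(1) W'(1) _ s(2)]) simp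
    moreover have "insert x (W - {x}) = W" "insert {x, y} (F - {e}) = F"
      using x e(1) y(1) by auto
    ultimately show ?thesis by auto
  qed
qed

theorem theorem5p1:
  fixes n :: nat and W :: "nat set" and EH :: "nat set set"
  assumes "n \<ge> 4"
    and "W \<subseteq> {0..<n}" and "card W = n - 2"
    and "simple_graph W EH" and "card EH \<le> n - 4"
    and "\<And>m E. 3 \<le> m \<Longrightarrow> m \<le> n - 1 \<Longrightarrow> simple_graph {0..<m} E \<Longrightarrow>
           card (complement_edges {0..<m} E) \<le> m - 3 \<Longrightarrow> q_graph m E = 2"
  shows "q_graph n (complete_edges {0..<n} - EH) = 2"
proof -
  have W: "finite W" "EH \<subseteq> complete_edges W"
    using assms(4) by (auto simp: simple_graph_def)
  have cW: "card W = (n - 4) + 2" using assms(1,3) by simp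
  obtain W1 W2 where split: "sparse_split W EH W1 W2"
    using sparse_split_exists[OF W(1) cW W(2) assms(5)] by blast
  have S: "W = W1 \<union> W2" "W1 \<inter> W2 = {}" "W1 \<noteq> {}" "W2 \<noteq> {}"
    "EH \<subseteq> complete_edges W1 \<union> complete_edges W2"
    "card (EH \<inter> complete_edges W1) < card W1" "card (EH \<inter> complete_edges W2) < card W2"
    using split unfolding sparse_split_def by auto
  have fin: "finite W1" "finite W2" using W(1) S(1) by auto
  have cards: "card W1 + card W2 = n - 2" "card W1 > 0" "card W2 > 0"
    using card_Un_disjoint[OF fin S(2)] assms(3) S(1,3,4) fin by (auto simp: card_gt_0_iff)
  have "card ({0..<n} - W) = 2"
    using card_Diff_subset[OF W(1) assms(2)] assms(1,3) by simp
  then obtain u v where uv: "{0..<n} - W = {u, v}" "u \<noteq> v"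
    by (auto simp: card_2_iff)
  have uvW: "u \<notin> W1 \<union> W2" "v \<notin> W1 \<union> W2" "u < n" "v < n" using uv(1) S(1) by auto
  have V: "{0..<n} = insert u (insert v (W1 \<union> W2))"
    using uv(1) assms(2) S(1) by auto
  have part: "\<exists>p. symmetric_idempotent (insert u (insert v U)) p \<and>
      has_pattern (insert u (insert v U)) (complete_edges (insert u (insert v U)) - (EH \<inter> complete_edges U)) p"
    if U: "finite U" "u \<notin> U" "v \<notin> U" "card U > 0" "card U < n - 2" "card (EH \<inter> complete_edges U) < card U" for U
  proof (rule idempotent_pattern_of_small_graphs)
    show "card (insert u (insert v U)) = card U + 2" using U uv(2) by simp
    \<comment> \<open>The order \<open>card U + 2\<close> is at least 3 because \<open>U\<close> is
      nonempty, and at most n - 1 because the other side is nonempty too.\<close>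
    show "q_graph (card U + 2) E = 2" if "simple_graph {0..<card U + 2} E"
      "card (complement_edges {0..<card U + 2} E) \<le> card U + 2 - 3" for E
      by (rule assms(6)) (use that U in auto)
  qed (use U in \<open>auto simp: complete_edges_def\<close>)
  obtain p1 where p1: "symmetric_idempotent (insert u (insert v W1)) p1"
    "has_pattern (insert u (insert v W1)) (complete_edges (insert u (insert v W1)) - (EH \<inter> complete_edges W1)) p1"
    using part[OF fin(1)] uvW cards S(6) by auto
  obtain p2 where p2: "symmetric_idempotent (insert u (insert v W2)) p2"
    "has_pattern (insert u (insert v W2)) (complete_edges (insert u (insert v W2)) - (EH \<inter> complete_edges W2)) p2"
    using part[OF fin(2)] uvW cards S(7) by auto
  have EH: "EH \<inter> complete_edges W1 \<union> EH \<inter> complete_edges W2 = EH"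
    using S(5) by auto
  obtain p where p: "symmetric_idempotent {0..<n} p" "has_pattern {0..<n} (complete_edges {0..<n} - EH) p"
    using idempotent_pattern_amalgam[OF fin S(2) uvW(1,2) uv(2) _ _ p1 p2] unfolding V[symmetric] EH by auto
  \<comment> \<open>This edge excludes fewer than two eigenvalues.\<close>
  have "{u, v} \<in> complete_edges {0..<n} - EH"
    using uvW uv W(2) S(1) by (auto simp: complete_edges_def)
  then show ?thesis
    by (rule q_graph_2_of_idempotent[OF p uvW(3,4) uv(2)])
qed

end
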